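(* Let $$W=\left\{x=(x(1),x(2),\dots)\in c:\ \lim_{i}x(i)=\sum_{i=1}^{\infty}\frac{x(i)}{2^{i}}\right\}.$$ The hyperplane $W$ of $c$ has the following properties: (a) The map $\phi:\ell_1\to W^*$ defined by $$(\phi(y))(x)=\sum_{j=1}^{\infty}x(j)y(j),$$ where $y=(y(1),y(2),\dots)\in\ell_1$ and $x=(x(1),x(2),\dots)\in W$, is an onto isometry. Moreover, if $(e_n^* )$ denotes the standard basis of $\ell_1$, then $$e_n^*\overset{\sigma(\ell_1,W)}{\longrightarrow}e^*=\left(\frac12,\frac1{2^2},\frac1{2^3},\dots\right).$$ (b) $W$ does not contain a subspace linearly isometric to $c$. (c) The set $$K=\left\{(y(1),y(2),\dots)\in\ell_1:\ \sum_{i=1}^{\infty}y(i)=1,\ y(i)\geq 0,\ i=1,2,\dots\right\}$$ is an infinite dimensional $\sigma(\ell_1,W)$-closed proper face of $B_{\ell_1}$. (d) $x=(1,1,\dots,1,\dots)$ is an extreme point of $B_W$; consequently, $W$ is isometric to $A(K)$, where $K$ is the set in (c), with the topology $\sigma(\ell_1,W)$. (e) $W$ is polyhedral.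
   Context: All Banach spaces are real. $c$ denotes the Banach space of all real convergent sequences with the supremum norm, and $W$ carries the norm of $c$. $B_X$ denotes the closed unit ball of a Banach space $X$, and $X^*$ its dual. The topology $\sigma(\ell_1,W)$ is the weak$^*$ topology on $\ell_1$ obtained by identifying $\ell_1$ with $W^*$ through the map $\phi$ of item (a). A convex subset $F$ of $B_X$ is a face of $B_X$ if whenever $x,y\in B_X$, $\lambda\in(0,1)$ and $(1-\lambda)x+\lambda y\in F$, one has $x,y\in F$; it is a proper face if $F\neq B_X$. For a Choquet simplex $K$, $A(K)$ denotes the space of all affine continuous real functions on $K$ with the supremum norm. A Banach space is polyhedral if the unit balls of all its finite-dimensional subspaces are polytopes. *)

theory Defs
  imports "HOL-Analysis.Analysis"
begin

text \<open>Sequences are indexed from 0, so the coordinate written x(i) on paper has index i - 1 here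
  and the weight 1/2^i becomes \<open>1 / 2 ^ Suc i\<close>.\<close>

typedef cseq = "{x :: nat \<Rightarrow> real. convergent x}"
  morphisms cseq_nth Cseq
  by (auto intro: convergent_const)

setup_lifting type_definition_cseq

lemma cseq_eqI: "(\<And>i. cseq_nth x i = cseq_nth y i) \<Longrightarrow> x = y"
  by transfer auto

lemma convergent_cseq_nth: "convergent (cseq_nth x)"
  using cseq_nth[of x] by simp

instantiation cseq :: real_vector
begin

lift_definition zero_cseq :: cseq is "\<lambda>i. 0" by (rule convergent_const)
lift_definition plus_cseq :: "cseq \<Rightarrow> cseq \<Rightarrow> cseq" is "\<lambda>x y i. x i + y i"
  by (rule convergent_add)
lift_definition minus_cseq :: "cseq \<Rightarrow> cseq \<Rightarrow> cseq" is "\<lambda>x y i. x i - y i"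
  by (rule convergent_diff)
lift_definition uminus_cseq :: "cseq \<Rightarrow> cseq" is "\<lambda>x i. - x i"
  by (metis convergent_minus_iff)
lift_definition scaleR_cseq :: "real \<Rightarrow> cseq \<Rightarrow> cseq" is "\<lambda>r x i. r * x i"
  by (rule convergent_mult[OF convergent_const])

instance
  by standard (transfer; simp add: algebra_simps)+

end

lemmas cseq_nth_simps [simp] =
  zero_cseq.rep_eq plus_cseq.rep_eq minus_cseq.rep_eq uminus_cseq.rep_eq scaleR_cseq.rep_eq

lemma cseq_bdd: "bdd_above (range (\<lambda>i. \<bar>cseq_nth x i\<bar>))"
proof -
  obtain K where "\<forall>n. norm (cseq_nth x n) \<le> K"
    using convergent_imp_Bseq[OF convergent_cseq_nth] by (auto simp: Bseq_def)
  then show ?thesis by (auto intro!: bdd_aboveI[of _ K])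
qed

instantiation cseq :: real_normed_vector
begin

definition norm_cseq :: "cseq \<Rightarrow> real" where "norm_cseq x = (SUP i. \<bar>cseq_nth x i\<bar>)"
definition dist_cseq :: "cseq \<Rightarrow> cseq \<Rightarrow> real" where "dist_cseq x y = norm (x - y)"
definition sgn_cseq :: "cseq \<Rightarrow> cseq" where "sgn_cseq x = x /\<^sub>R norm x"
definition uniformity_cseq :: "(cseq \<times> cseq) filter"
  where "uniformity_cseq = (INF e\<in>{0 <..}. principal {(x, y). dist x y < e})"
definition open_cseq :: "cseq set \<Rightarrow> bool"
  where "open_cseq S = (\<forall>x\<in>S. \<forall>\<^sub>F (x', y) in uniformity. x' = x \<longrightarrow> y \<in> S)"

lemma cseq_nth_le_norm: "\<bar>cseq_nth x i\<bar> \<le> norm x"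
  unfolding norm_cseq_def by (rule cSUP_upper[OF _ cseq_bdd]) simp

lemma cseq_norm_le: "(\<And>i. \<bar>cseq_nth x i\<bar> \<le> b) \<Longrightarrow> norm x \<le> b"
  unfolding norm_cseq_def by (rule cSUP_least) auto

instance
proof
  fix a :: real and x y :: cseq
  show "norm x = 0 \<longleftrightarrow> x = 0"
  proof
    assume "norm x = 0"
    then show "x = 0"
      using cseq_nth_le_norm[of x] by (intro cseq_eqI) simp
  qed (simp add: norm_cseq_def)
  show "norm (x + y) \<le> norm x + norm y"
    by (rule cseq_norm_le)
      (metis abs_triangle_ineq add_mono cseq_nth_le_norm order_trans plus_cseq.rep_eq)
  have le: "norm (r *\<^sub>R z) \<le> \<bar>r\<bar> * norm z" for r and z :: cseq
    by (rule cseq_norm_le) (simp add: abs_mult cseq_nth_le_norm mult_left_mono)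
  show "norm (a *\<^sub>R x) = \<bar>a\<bar> * norm x"
  proof (cases "a = 0")
    case True
    then show ?thesis by (simp add: norm_cseq_def)
  next
    case False
    have "norm x \<le> \<bar>inverse a\<bar> * norm (a *\<^sub>R x)"
      using le[of "inverse a" "a *\<^sub>R x"] False by simp
    then have "\<bar>a\<bar> * norm x \<le> norm (a *\<^sub>R x)"
      using False by (simp add: field_simps)
    with le[of a x] show ?thesis by simp
  qed
qed (auto simp: dist_cseq_def sgn_cseq_def uniformity_cseq_def open_cseq_def)

end

instance cseq :: banach
proof
  fix X :: "nat \<Rightarrow> cseq"
  assume "Cauchy X"
  have near: "\<exists>M. \<forall>m\<ge>M. \<forall>n\<ge>M. \<forall>i. \<bar>cseq_nth (X m) i - cseq_nth (X n) i\<bar> < e" if "e > 0" for e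
  proof -
    obtain M where M: "\<forall>m\<ge>M. \<forall>n\<ge>M. norm (X m - X n) < e"
      using \<open>Cauchy X\<close> \<open>e > 0\<close> unfolding Cauchy_def dist_norm by blast
    have "\<bar>cseq_nth (X m) i - cseq_nth (X n) i\<bar> < e" if "m \<ge> M" "n \<ge> M" for m n i
      using cseq_nth_le_norm[of "X m - X n" i] M that by (simp add: le_less_trans)
    then show ?thesis by blast
  qed
  have "convergent (\<lambda>m. cseq_nth (X m) i)" for i
    unfolding Cauchy_convergent_iff[symmetric] Cauchy_def dist_real_def using near by blast
  then obtain y where y: "\<And>i. (\<lambda>m. cseq_nth (X m) i) \<longlonglongrightarrow> y i"
    unfolding convergent_def by metis
  have close: "\<exists>M. \<forall>m\<ge>M. \<forall>i. \<bar>cseq_nth (X m) i - y i\<bar> \<le> e" if e: "e > 0" for e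
  proof -
    obtain M where M: "\<forall>m\<ge>M. \<forall>n\<ge>M. \<forall>i. \<bar>cseq_nth (X m) i - cseq_nth (X n) i\<bar> < e"
      using near[OF e] by blast
    have "\<bar>cseq_nth (X m) i - y i\<bar> \<le> e" if "m \<ge> M" for m i
    proof (rule LIMSEQ_le_const2)
      show "(\<lambda>n. \<bar>cseq_nth (X m) i - cseq_nth (X n) i\<bar>) \<longlonglongrightarrow> \<bar>cseq_nth (X m) i - y i\<bar>"
        by (intro tendsto_intros y)
      show "\<exists>N. \<forall>n\<ge>N. \<bar>cseq_nth (X m) i - cseq_nth (X n) i\<bar> \<le> e"
        using M that less_imp_le by blast
    qed
    then show ?thesis by blast
  qed
  have "Cauchy y"
    unfolding Cauchy_def dist_real_def
  proof (intro allI impI)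
    fix e :: real assume "e > 0"
    then obtain m where m: "\<And>i. \<bar>cseq_nth (X m) i - y i\<bar> \<le> e / 4"
      using close[of "e / 4"] by auto
    have "Cauchy (cseq_nth (X m))"
      using convergent_cseq_nth by (simp add: Cauchy_convergent_iff)
    then obtain M where M: "\<And>i j. i \<ge> M \<Longrightarrow> j \<ge> M \<Longrightarrow> \<bar>cseq_nth (X m) i - cseq_nth (X m) j\<bar> < e / 4"
      unfolding Cauchy_def dist_real_def
      by (metis \<open>e > 0\<close> divide_pos_pos zero_less_numeral)
    have "\<bar>y i - y j\<bar> < e" if "i \<ge> M" "j \<ge> M" for i j
      using m[of i] m[of j] M[OF that] \<open>e > 0\<close> by linarith
    then show "\<exists>M. \<forall>i\<ge>M. \<forall>j\<ge>M. \<bar>y i - y j\<bar> < e" by blast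
  qed
  then have conv: "convergent y" by (simp add: Cauchy_convergent_iff)
  define Y where "Y = Cseq y"
  have Y: "cseq_nth Y = y" unfolding Y_def using conv by (simp add: Cseq_inverse)
  have "X \<longlonglongrightarrow> Y"
    unfolding lim_sequentially dist_norm
  proof (intro allI impI)
    fix e :: real assume "e > 0"
    then obtain M where "\<forall>m\<ge>M. \<forall>i. \<bar>cseq_nth (X m) i - y i\<bar> \<le> e / 2"
      using close[of "e / 2"] by auto
    then have "norm (X m - Y) \<le> e / 2" if "m \<ge> M" for m
      using that by (intro cseq_norm_le) (simp add: Y)
    with \<open>e > 0\<close> show "\<exists>M. \<forall>m\<ge>M. norm (X m - Y) < e"
      by (intro exI[of _ M]) (fastforce intro: le_less_trans)
  qed
  then show "convergent X" by (rule convergentI)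
qed

definition W_set :: "cseq set"
  where "W_set = {x. lim (cseq_nth x) = (\<Sum>i. cseq_nth x i / 2 ^ Suc i)}"

lemma summable_half: "summable (\<lambda>i. 1 / 2 ^ Suc i :: real)"
  using sums_summable[OF power_half_series] by (simp add: power_divide)

lemma suminf_half: "(\<Sum>i. 1 / 2 ^ Suc i :: real) = 1"
  using power_half_series by (simp add: sums_iff power_divide)

lemma summable_cseq_half: "summable (\<lambda>i. cseq_nth x i / 2 ^ Suc i)"
proof (rule summable_comparison_test')
  show "summable (\<lambda>i. norm x * (1 / 2 ^ Suc i))"
    by (intro summable_mult summable_half)
  show "norm (cseq_nth x i / 2 ^ Suc i) \<le> norm x * (1 / 2 ^ Suc i)" if "i \<ge> 0" for i
    using cseq_nth_le_norm[of x i] by (simp add: divide_right_mono)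
qed

lemma W_set_hyperplane:
  defines "f \<equiv> \<lambda>x. lim (cseq_nth x) - (\<Sum>i. cseq_nth x i / 2 ^ Suc i)"
  shows "bounded_linear f" "\<exists>x. f x \<noteq> 0" "W_set = {x. f x = 0}"
proof -
  have L: "cseq_nth x \<longlonglongrightarrow> lim (cseq_nth x)" for x
    using convergent_cseq_nth convergent_LIMSEQ_iff by blast
  have limadd: "lim (\<lambda>i. cseq_nth x i + cseq_nth y i) = lim (cseq_nth x) + lim (cseq_nth y)" for x y
    by (rule limI) (intro tendsto_add L)
  have limsc: "lim (\<lambda>i. r * cseq_nth x i) = r * lim (cseq_nth x)" for r x
    by (rule limI) (intro tendsto_mult tendsto_const L)
  have limle: "\<bar>lim (cseq_nth x)\<bar> \<le> norm x" for x
    by (rule LIMSEQ_le_const2[OF tendsto_rabs[OF L]]) (use cseq_nth_le_norm in blast)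
  have sumle: "\<bar>\<Sum>i. cseq_nth x i / 2 ^ Suc i\<bar> \<le> norm x" for x
  proof -
    have sm: "summable (\<lambda>i. norm x * (1 / 2 ^ Suc i))"
      by (intro summable_mult summable_half)
    have "norm (cseq_nth x i / 2 ^ Suc i) \<le> norm x * (1 / 2 ^ Suc i)" for i
      using cseq_nth_le_norm[of x i] by (simp add: divide_right_mono)
    from norm_suminf_le[OF this sm]
    have "norm (\<Sum>i. cseq_nth x i / 2 ^ Suc i) \<le> (\<Sum>i. norm x * (1 / 2 ^ Suc i))" .
    also have "\<dots> = norm x"
      using suminf_mult[OF summable_half, of "norm x"] suminf_half by simp
    finally show ?thesis by simp
  qed
  show "bounded_linear f"
  proof (rule bounded_linear_intro[where K = 2])
    fix x y
    have "(\<Sum>i. (cseq_nth x i + cseq_nth y i) / 2 ^ Suc i)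
        = (\<Sum>i. cseq_nth x i / 2 ^ Suc i) + (\<Sum>i. cseq_nth y i / 2 ^ Suc i)"
      unfolding add_divide_distrib by (rule suminf_add[symmetric]; rule summable_cseq_half)
    then show "f (x + y) = f x + f y"
      by (simp only: f_def plus_cseq.rep_eq limadd)
  next
    fix r x
    have "(\<Sum>i. r * cseq_nth x i / 2 ^ Suc i) = r * (\<Sum>i. cseq_nth x i / 2 ^ Suc i)"
      using suminf_mult[OF summable_cseq_half, of r x] by simp
    then show "f (r *\<^sub>R x) = r *\<^sub>R f x"
      by (simp only: f_def scaleR_cseq.rep_eq limsc) (simp add: algebra_simps)
  next
    fix x
    show "norm (f x) \<le> norm x * 2"
      using limle[of x] sumle[of x] by (simp only: f_def real_norm_def)
  qed
  show "\<exists>x. f x \<noteq> 0"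
  proof -
    define z where "z = (\<lambda>i::nat. if i = 0 then 1 else 0 :: real)"
    have z: "z \<longlonglongrightarrow> 0"
      by (rule tendsto_eventually) (auto simp: z_def eventually_sequentially intro!: exI[of _ 1])
    have "(\<lambda>i. z i / 2 ^ Suc i) sums (\<Sum>i\<in>{0}. z i / 2 ^ Suc i)"
      by (rule sums_finite) (auto simp: z_def)
    then have "(\<Sum>i. z i / 2 ^ Suc i) = 1 / 2"
      by (simp add: sums_iff z_def)
    moreover have "cseq_nth (Cseq z) = z"
      using z by (auto intro!: Cseq_inverse convergentI)
    ultimately have "f (Cseq z) \<noteq> 0"
      using limI[OF z] by (simp add: f_def)
    then show ?thesis ..
  qed
  show "W_set = {x. f x = 0}" by (auto simp: W_set_def f_def)
qed

lemma subspace_W_set: "subspace W_set"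
  unfolding W_set_hyperplane(3)
  by (intro linear_subspace_kernel bounded_linear.linear W_set_hyperplane(1))

lemma closed_W_set: "closed W_set"
  unfolding W_set_hyperplane(3)
  by (intro closed_Collect_eq continuous_on_const linear_continuous_on W_set_hyperplane(1))

text \<open>W as a Banach space in its own right: vector operations and norm are those of \<^typ>\<open>cseq\<close>.\<close>

typedef W = W_set
  morphisms W_cseq W_of_cseq
  using subspace_0[OF subspace_W_set] by blast

setup_lifting type_definition_W

instantiation W :: real_vector
begin

lift_definition zero_W :: W is 0 by (rule subspace_0[OF subspace_W_set])
lift_definition plus_W :: "W \<Rightarrow> W \<Rightarrow> W" is "(+)" by (rule subspace_add[OF subspace_W_set])
lift_definition minus_W :: "W \<Rightarrow> W \<Rightarrow> W" is "(-)" by (rule subspace_diff[OF subspace_W_set])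
lift_definition uminus_W :: "W \<Rightarrow> W" is uminus by (rule subspace_neg[OF subspace_W_set])
lift_definition scaleR_W :: "real \<Rightarrow> W \<Rightarrow> W" is scaleR by (rule subspace_scale[OF subspace_W_set])

instance
  by standard (transfer; simp add: algebra_simps)+

end

instantiation W :: real_normed_vector
begin

lift_definition norm_W :: "W \<Rightarrow> real" is norm .
definition dist_W :: "W \<Rightarrow> W \<Rightarrow> real" where "dist_W x y = norm (x - y)"
definition sgn_W :: "W \<Rightarrow> W" where "sgn_W x = x /\<^sub>R norm x"
definition uniformity_W :: "(W \<times> W) filter"
  where "uniformity_W = (INF e\<in>{0 <..}. principal {(x, y). dist x y < e})"
definition open_W :: "W set \<Rightarrow> bool"
  where "open_W S = (\<forall>x\<in>S. \<forall>\<^sub>F (x', y) in uniformity. x' = x \<longrightarrow> y \<in> S)"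

instance
proof
  fix a :: real and x y :: W
  show "norm x = 0 \<longleftrightarrow> x = 0" by transfer simp
  show "norm (x + y) \<le> norm x + norm y" by transfer (rule norm_triangle_ineq)
  show "norm (a *\<^sub>R x) = \<bar>a\<bar> * norm x" by transfer simp
qed (auto simp: dist_W_def sgn_W_def uniformity_W_def open_W_def)

end

instance W :: banach
proof
  fix X :: "nat \<Rightarrow> W"
  assume "Cauchy X"
  have d: "dist (W_cseq x) (W_cseq y) = dist x y" for x y
    by (simp add: dist_norm norm_W.rep_eq minus_W.rep_eq)
  have "Cauchy (\<lambda>n. W_cseq (X n))"
    using \<open>Cauchy X\<close> by (simp add: Cauchy_def d)
  then obtain l where l: "(\<lambda>n. W_cseq (X n)) \<longlonglongrightarrow> l"
    using Cauchy_convergent convergent_def by blast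
  have "l \<in> W_set"
    using closed_sequentially[OF closed_W_set _ l] W_cseq by blast
  then have "W_cseq (W_of_cseq l) = l" by (rule W_of_cseq_inverse)
  then have "X \<longlonglongrightarrow> W_of_cseq l"
    using l by (simp add: lim_sequentially flip: d)
  then show "convergent X" by (rule convergentI)
qed

definition W_nth :: "W \<Rightarrow> nat \<Rightarrow> real"
  where "W_nth x = cseq_nth (W_cseq x)"

lift_definition const_one_cseq :: cseq is "\<lambda>i. 1" by (rule convergent_const)

lift_definition W_one :: W is const_one_cseq
proof -
  have "lim (\<lambda>i::nat. 1::real) = 1" by (rule limI) (rule tendsto_const)
  then show "const_one_cseq \<in> W_set"
    using suminf_half by (simp add: W_set_def const_one_cseq.rep_eq)
qed

lemma W_nth_W_one: "W_nth W_one i = 1"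
  by (simp add: W_nth_def W_one.rep_eq const_one_cseq.rep_eq)

typedef l1 = "{y :: nat \<Rightarrow> real. summable (\<lambda>i. \<bar>y i\<bar>)}"
  morphisms l1_nth L1
  by (rule exI[of _ "\<lambda>_. 0"]) simp

setup_lifting type_definition_l1

lemma l1_eqI: "(\<And>i. l1_nth x i = l1_nth y i) \<Longrightarrow> x = y"
  by transfer auto

lemma summable_abs_l1: "summable (\<lambda>i. \<bar>l1_nth y i\<bar>)"
  using l1_nth[of y] by simp

lemma summable_abs_add:
  fixes x y :: "nat \<Rightarrow> real"
  assumes "summable (\<lambda>i. \<bar>x i\<bar>)" "summable (\<lambda>i. \<bar>y i\<bar>)"
  shows "summable (\<lambda>i. \<bar>x i + y i\<bar>)"
  by (rule summable_comparison_test'[OF summable_add[OF assms]]) (simp add: abs_triangle_ineq)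

instantiation l1 :: real_vector
begin

lift_definition zero_l1 :: l1 is "\<lambda>i. 0" by simp
lift_definition plus_l1 :: "l1 \<Rightarrow> l1 \<Rightarrow> l1" is "\<lambda>x y i. x i + y i"
  by (rule summable_abs_add)
lift_definition minus_l1 :: "l1 \<Rightarrow> l1 \<Rightarrow> l1" is "\<lambda>x y i. x i - y i"
  subgoal for x y using summable_abs_add[of x "\<lambda>i. - y i"] by simp
  done
lift_definition uminus_l1 :: "l1 \<Rightarrow> l1" is "\<lambda>x i. - x i" by simp
lift_definition scaleR_l1 :: "real \<Rightarrow> l1 \<Rightarrow> l1" is "\<lambda>r x i. r * x i"
  by (simp add: abs_mult summable_mult)

instance
  by standard (transfer; simp add: algebra_simps)+

end

lemmas l1_nth_simps [simp] =
  zero_l1.rep_eq plus_l1.rep_eq minus_l1.rep_eq uminus_l1.rep_eq scaleR_l1.rep_eq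

instantiation l1 :: real_normed_vector
begin

definition norm_l1 :: "l1 \<Rightarrow> real" where "norm_l1 y = (\<Sum>i. \<bar>l1_nth y i\<bar>)"
definition dist_l1 :: "l1 \<Rightarrow> l1 \<Rightarrow> real" where "dist_l1 x y = norm (x - y)"
definition sgn_l1 :: "l1 \<Rightarrow> l1" where "sgn_l1 x = x /\<^sub>R norm x"
definition uniformity_l1 :: "(l1 \<times> l1) filter"
  where "uniformity_l1 = (INF e\<in>{0 <..}. principal {(x, y). dist x y < e})"
definition open_l1 :: "l1 set \<Rightarrow> bool"
  where "open_l1 S = (\<forall>x\<in>S. \<forall>\<^sub>F (x', y) in uniformity. x' = x \<longrightarrow> y \<in> S)"

instance
proof
  fix a :: real and x y :: l1
  show "norm x = 0 \<longleftrightarrow> x = 0"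
    by (auto simp: norm_l1_def suminf_eq_zero_iff[OF summable_abs_l1] intro: l1_eqI)
  show "norm (x + y) \<le> norm x + norm y"
    unfolding norm_l1_def suminf_add[OF summable_abs_l1 summable_abs_l1] plus_l1.rep_eq
    by (intro suminf_le abs_triangle_ineq summable_abs_add summable_add summable_abs_l1)
  show "norm (a *\<^sub>R x) = \<bar>a\<bar> * norm x"
    by (simp add: norm_l1_def abs_mult suminf_mult[OF summable_abs_l1])
qed (auto simp: dist_l1_def sgn_l1_def uniformity_l1_def open_l1_def)

end

instance l1 :: banach
proof
  fix X :: "nat \<Rightarrow> l1"
  assume "Cauchy X"
  have part: "(\<Sum>i<k. \<bar>l1_nth y i\<bar>) \<le> norm y" for k y
    unfolding norm_l1_def by (rule sum_le_suminf[OF summable_abs_l1]) auto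
  have coord: "\<bar>l1_nth y i\<bar> \<le> norm y" for i y
  proof -
    have "0 \<le> (\<Sum>j<i. \<bar>l1_nth y j\<bar>)" by (rule sum_nonneg) simp
    then show ?thesis using part[of y "Suc i"] unfolding sum.lessThan_Suc by linarith
  qed
  have "convergent (\<lambda>m. l1_nth (X m) i)" for i
    unfolding Cauchy_convergent_iff[symmetric] Cauchy_def dist_real_def
  proof (intro allI impI)
    fix e :: real assume "e > 0"
    then obtain M where "\<forall>m\<ge>M. \<forall>n\<ge>M. norm (X m - X n) < e"
      using \<open>Cauchy X\<close> by (auto simp: Cauchy_def dist_norm)
    then show "\<exists>M. \<forall>m\<ge>M. \<forall>n\<ge>M. \<bar>l1_nth (X m) i - l1_nth (X n) i\<bar> < e"
      by (metis coord le_less_trans minus_l1.rep_eq)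
  qed
  then obtain y where y: "\<And>i. (\<lambda>m. l1_nth (X m) i) \<longlonglongrightarrow> y i"
    unfolding convergent_def by metis
  have close: "\<exists>M. \<forall>m\<ge>M. \<forall>k. (\<Sum>i<k. \<bar>l1_nth (X m) i - y i\<bar>) \<le> e" if e: "e > 0" for e
  proof -
    obtain M where M: "\<And>m n. m \<ge> M \<Longrightarrow> n \<ge> M \<Longrightarrow> norm (X m - X n) < e"
      using \<open>Cauchy X\<close> e unfolding Cauchy_def dist_norm by meson
    have "(\<Sum>i<k. \<bar>l1_nth (X m) i - y i\<bar>) \<le> e" if "m \<ge> M" for m k
    proof (rule LIMSEQ_le_const2)
      show "(\<lambda>n. \<Sum>i<k. \<bar>l1_nth (X m) i - l1_nth (X n) i\<bar>) \<longlonglongrightarrow> (\<Sum>i<k. \<bar>l1_nth (X m) i - y i\<bar>)"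
        by (intro tendsto_intros y)
      have "(\<Sum>i<k. \<bar>l1_nth (X m) i - l1_nth (X n) i\<bar>) \<le> e" if "n \<ge> M" for n
        using part[of "X m - X n" k] M[OF \<open>m \<ge> M\<close> that] by simp
      then show "\<exists>N. \<forall>n\<ge>N. (\<Sum>i<k. \<bar>l1_nth (X m) i - l1_nth (X n) i\<bar>) \<le> e" by blast
    qed
    then show ?thesis by blast
  qed
  have sm: "summable (\<lambda>i. \<bar>l1_nth (X m) i - y i\<bar>)"
    if "\<forall>k. (\<Sum>i<k. \<bar>l1_nth (X m) i - y i\<bar>) \<le> e" for m e
    by (rule summableI_nonneg_bounded[where x = e]) (use that in auto)
  obtain m where "summable (\<lambda>i. \<bar>l1_nth (X m) i - y i\<bar>)"
    using close[of 1] sm by (meson less_numeral_extra(1) order_refl)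
  from summable_abs_add[OF summable_abs_l1[of "X m"], of "\<lambda>i. y i - l1_nth (X m) i"] this
  have "summable (\<lambda>i. \<bar>y i\<bar>)" by (simp add: abs_minus_commute)
  define Y where "Y = L1 y"
  have Y: "l1_nth Y = y" unfolding Y_def using \<open>summable (\<lambda>i. \<bar>y i\<bar>)\<close> by (simp add: L1_inverse)
  have "X \<longlonglongrightarrow> Y"
    unfolding lim_sequentially dist_norm
  proof (intro allI impI)
    fix e :: real assume "e > 0"
    then obtain M where M: "\<forall>m\<ge>M. \<forall>k. (\<Sum>i<k. \<bar>l1_nth (X m) i - y i\<bar>) \<le> e / 2"
      using close[of "e / 2"] by auto
    have "norm (X m - Y) < e" if "m \<ge> M" for m
    proof -
      have b: "\<forall>k. (\<Sum>i<k. \<bar>l1_nth (X m) i - y i\<bar>) \<le> e / 2" using M that by blast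
      have "(\<Sum>i. \<bar>l1_nth (X m) i - y i\<bar>) \<le> e / 2"
        by (rule suminf_le_const[OF sm[OF b]]) (use b in blast)
      with \<open>e > 0\<close> show ?thesis by (simp add: norm_l1_def Y)
    qed
    then show "\<exists>M. \<forall>m\<ge>M. norm (X m - Y) < e" by blast
  qed
  then show "convergent X" by (rule convergentI)
qed

lift_definition l1_basis :: "nat \<Rightarrow> l1" is "\<lambda>n i. if i = n then 1 else 0"
  subgoal for n by (rule summable_finite[of "{n}"]) auto
  done

lift_definition e_star :: l1 is "\<lambda>i. 1 / 2 ^ Suc i"
  using summable_half by simp

definition phi :: "l1 \<Rightarrow> (W \<Rightarrow>\<^sub>L real)"
  where "phi y = Blinfun (\<lambda>x. \<Sum>j. W_nth x j * l1_nth y j)"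

text \<open>\<open>Blinfun\<close> is only meaningful on bounded linear maps, hence the following.\<close>

lemma phi_apply: "blinfun_apply (phi y) x = (\<Sum>j. W_nth x j * l1_nth y j)"
proof -
  have le: "norm (W_nth x j * l1_nth y j) \<le> norm x * \<bar>l1_nth y j\<bar>" for x j
    using cseq_nth_le_norm[of "W_cseq x" j]
    by (simp add: abs_mult W_nth_def norm_W.rep_eq mult_right_mono)
  have sm: "summable (\<lambda>j. W_nth x j * l1_nth y j)" for x
    by (rule summable_comparison_test'[OF summable_mult[OF summable_abs_l1] le])
  have "bounded_linear (\<lambda>x. \<Sum>j. W_nth x j * l1_nth y j)"
  proof (rule bounded_linear_intro[where K = "norm y"])
    fix u v
    show "(\<Sum>j. W_nth (u + v) j * l1_nth y j)
        = (\<Sum>j. W_nth u j * l1_nth y j) + (\<Sum>j. W_nth v j * l1_nth y j)"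
      unfolding suminf_add[OF sm sm] by (simp add: W_nth_def plus_W.rep_eq algebra_simps)
  next
    fix r u
    show "(\<Sum>j. W_nth (r *\<^sub>R u) j * l1_nth y j) = r *\<^sub>R (\<Sum>j. W_nth u j * l1_nth y j)"
      using suminf_mult[OF sm, of r u] by (simp add: W_nth_def scaleR_W.rep_eq algebra_simps)
  next
    fix u
    have "norm (\<Sum>j. W_nth u j * l1_nth y j) \<le> (\<Sum>j. norm u * \<bar>l1_nth y j\<bar>)"
      by (rule norm_suminf_le[OF le summable_mult[OF summable_abs_l1]])
    then show "norm (\<Sum>j. W_nth u j * l1_nth y j) \<le> norm u * norm y"
      by (simp add: suminf_mult[OF summable_abs_l1] norm_l1_def)
  qed
  then show ?thesis
    unfolding phi_def by (simp add: bounded_linear_Blinfun_apply)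
qed

text \<open>For scalar-valued operators the library's strong operator topology is the topology of
  pointwise convergence of functionals, i.e. the weak-star topology of the dual.\<close>

abbreviation weak_star_topology :: "('a::real_normed_vector \<Rightarrow>\<^sub>L real) topology"
  where "weak_star_topology \<equiv> strong_operator_topology"

definition sigma_l1_W :: "l1 topology"
  where "sigma_l1_W = pullback_topology UNIV phi weak_star_topology"

definition K_set :: "l1 set"
  where "K_set = {y. (\<Sum>i. l1_nth y i) = 1 \<and> (\<forall>i. l1_nth y i \<ge> 0)}"

definition linear_isometry :: "('a::real_normed_vector \<Rightarrow> 'b::real_normed_vector) \<Rightarrow> bool"
  where "linear_isometry f \<longleftrightarrow> linear f \<and> (\<forall>x. norm (f x) = norm x)"

definition isometric_subspace :: "'b::real_normed_vector set \<Rightarrow> 'a::real_normed_vector itself \<Rightarrow> bool"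
  where "isometric_subspace S _ \<longleftrightarrow>
    subspace S \<and> (\<exists>f :: 'a \<Rightarrow> 'b. linear_isometry f \<and> range f = S)"

definition finite_dim :: "'a::real_vector set \<Rightarrow> bool"
  where "finite_dim S \<longleftrightarrow> (\<exists>B. finite B \<and> S \<subseteq> span B)"

definition polyhedral_space :: "'a::banach itself \<Rightarrow> bool"
  where "polyhedral_space _ \<longleftrightarrow>
    (\<forall>S :: 'a set. subspace S \<and> finite_dim S \<longrightarrow> polytope (cball 0 1 \<inter> S))"

definition locally_convex_hausdorff :: "'a::real_vector topology \<Rightarrow> bool"
  where "locally_convex_hausdorff T \<longleftrightarrow>
    topspace T = UNIV \<and> Hausdorff_space T \<and>
    continuous_map (prod_topology T T) T (\<lambda>(x, y). x + y) \<and>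
    continuous_map (prod_topology euclideanreal T) T (\<lambda>(r, x). r *\<^sub>R x) \<and>
    neighbourhood_base_of convex T"

text \<open>The cone with base \<open>K\<close>, where \<open>K\<close> is placed in the hyperplane at height 1 of
  \<open>'a \<times> real\<close> so that the hyperplane containing it misses the origin.\<close>

definition base_cone :: "'a::real_vector set \<Rightarrow> ('a \<times> real) set"
  where "base_cone K = {t *\<^sub>R (k, 1) | t k. t \<ge> 0 \<and> k \<in> K}"

text \<open>The vector space \<open>P - P\<close> is a lattice in the order \<open>u \<le> v \<longleftrightarrow> v - u \<in> P\<close>. Greatest
  lower bounds come for free through negation.\<close>

definition lattice_cone :: "'b::real_vector set \<Rightarrow> bool"
  where "lattice_cone P \<longleftrightarrow>
    (let D = {p - q | p q. p \<in> P \<and> q \<in> P} in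
      \<forall>u\<in>D. \<forall>v\<in>D. \<exists>w\<in>D. w - u \<in> P \<and> w - v \<in> P \<and>
        (\<forall>z\<in>D. z - u \<in> P \<and> z - v \<in> P \<longrightarrow> z - w \<in> P))"

definition choquet_simplex :: "'a::real_vector topology \<Rightarrow> 'a set \<Rightarrow> bool"
  where "choquet_simplex T K \<longleftrightarrow>
    locally_convex_hausdorff T \<and> convex K \<and> compactin T K \<and> lattice_cone (base_cone K)"

text \<open>Elements of \<open>A(K)\<close> are represented by functions that are \<open>undefined\<close> off \<open>K\<close>, so that
  they are determined by their values on \<open>K\<close>.\<close>

definition affine_cont :: "'a::real_vector topology \<Rightarrow> 'a set \<Rightarrow> ('a \<Rightarrow> real) set"
  where "affine_cont T K = {f \<in> extensional K.
    continuous_map (subtopology T K) euclideanreal f \<and>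
    (\<forall>x\<in>K. \<forall>y\<in>K. \<forall>t\<in>{0..1}. f ((1 - t) *\<^sub>R x + t *\<^sub>R y) = (1 - t) * f x + t * f y)}"

definition sup_norm_on :: "'a set \<Rightarrow> ('a \<Rightarrow> real) \<Rightarrow> real"
  where "sup_norm_on K f = (SUP k\<in>K. \<bar>f k\<bar>)"

definition isometric_to_affine_cont ::
    "'b::real_normed_vector itself \<Rightarrow> 'a::real_vector topology \<Rightarrow> 'a set \<Rightarrow> bool"
  where "isometric_to_affine_cont _ T K \<longleftrightarrow>
    (\<exists>F :: 'b \<Rightarrow> 'a \<Rightarrow> real.
      range F = affine_cont T K \<and>
      (\<forall>x y. \<forall>k\<in>K. F (x + y) k = F x k + F y k) \<and>
      (\<forall>r x. \<forall>k\<in>K. F (r *\<^sub>R x) k = r * F x k) \<and>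
      (\<forall>x. sup_norm_on K (F x) = norm x))"

end

theory Submission
  imports Defs
begin

text \<open>
  Throughout, the weights \<open>1 / 2 ^ Suc i\<close> form a strictly positive probability vector \<open>e_star\<close>, and
  \<open>W\<close> consists of the convergent sequences whose limit is their average against these weights.
  Each part of the theorem uses this averaging property.

  Duality. Any finite list of values in \<open>[-1, 1]\<close> extends to a vector of the unit ball of \<open>W\<close>: fill
  the tail with the one constant that is compatible with the averaging condition, which is the
  weighted mean of the list (\<open>W_extension\<close>). Prescribing the signs of \<open>y\<close> shows that \<open>phi\<close> is
  isometric. It is onto because the vectors \<open>d i\<close>, unit vectors corrected in coordinate 0 so that
  they lie in \<open>W\<close>, expand every \<open>x\<close> as \<open>lim x\<close> times \<open>W_one\<close> plus the norm convergent series of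
  \<open>(x i - lim x) *\<^sub>R d i\<close> (\<open>surj_phi\<close>). On \<open>W\<close> the limit functional is \<open>phi e_star\<close>; this is the
  weak-star convergence of the unit vectors to \<open>e_star\<close>.

  The simplex. In the ball of \<open>\<ell>\<^sub>1\<close> the set \<open>K_set\<close> is cut out by \<open>phi y W_one = 1\<close>, an equation in
  a weak-star continuous functional that is at most 1 on the ball (\<open>K_set_iff\<close>). So \<open>K_set\<close> is a face,
  and its image in the product topology is a closed set of linear functionals inside a product of compact
  intervals, hence compact. The cone over \<open>K_set\<close> is the positive cone of \<open>\<ell>\<^sub>1\<close>, a lattice under
  pointwise maxima. A continuous affine \<open>f\<close> on \<open>K_set\<close> satisfies \<open>f k = (\<Sum>i. k i * f (e i))\<close>, by
  splitting off one coordinate of \<open>k\<close> at a time (\<open>affine_cont_expansion\<close>); at \<open>k = e_star\<close>,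
  and with continuity of \<open>f\<close> there, this says exactly that \<open>f (e i)\<close> is a sequence in \<open>W\<close>.

  Polyhedrality. A nonzero \<open>z\<close> in \<open>W\<close> with limit 0 has weighted average 0, hence a positive coordinate,
  so its supremum is attained, and stably so under small perturbations. Compactness of the unit
  sphere gives a number \<open>N\<close> for which every vector of a given finite-dimensional space of such \<open>z\<close>
  attains its supremum among the first \<open>N\<close> coordinates. Adding multiples of \<open>W_one\<close> does not
  move the extremal coordinates, so the norm of any finite-dimensional subspace of \<open>W\<close> is a
  maximum over finitely many coordinates (\<open>norm_determined_in_finite_dim\<close>), and its ball is a polytope.
  The space \<open>c\<close> fails this: the vectors \<open>n \<mapsto> 1 - (t n - t m)^2\<close>, with \<open>t\<close> injective and
  convergent, span three dimensions, and each has norm 1, but no functional of norm 1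
  takes the value 1 at two of them. Hence \<open>c\<close> does not embed isometrically into \<open>W\<close>.
\<close>

section \<open>Coordinates, limits and extension of finite lists in \<open>W\<close>\<close>

lemma W_nth_simps [simp]:
  "W_nth 0 i = 0" "W_nth (x + y) i = W_nth x i + W_nth y i"
  "W_nth (x - y) i = W_nth x i - W_nth y i" "W_nth (- x) i = - W_nth x i"
  "W_nth (r *\<^sub>R x) i = r * W_nth x i" "W_nth W_one i = 1"
  by (simp_all add: W_nth_def zero_W.rep_eq plus_W.rep_eq minus_W.rep_eq uminus_W.rep_eq
      scaleR_W.rep_eq W_nth_W_one[unfolded W_nth_def])

lemma linear_W_nth: "linear (\<lambda>x. W_nth x i)"
  by (rule linearI) simp_all

lemma W_nth_sum [simp]: "W_nth (\<Sum>k\<in>A. f k) i = (\<Sum>k\<in>A. W_nth (f k) i)"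
  using linear_sum[OF linear_W_nth] by simp

lemma W_eqI: "(\<And>i. W_nth x i = W_nth y i) \<Longrightarrow> x = y"
  unfolding W_nth_def by (metis W_cseq_inject cseq_eqI)

lemma abs_W_nth_le_norm: "\<bar>W_nth x i\<bar> \<le> norm x"
  by (simp add: W_nth_def norm_W.rep_eq cseq_nth_le_norm)

lemma W_norm_le: "(\<And>i. \<bar>W_nth x i\<bar> \<le> b) \<Longrightarrow> norm x \<le> b"
  by (simp add: W_nth_def norm_W.rep_eq cseq_norm_le)

lemma norm_W_one: "norm W_one = 1"
  using abs_W_nth_le_norm[of W_one 0] W_norm_le[of W_one 1] by simp

text \<open>On \<open>W\<close> the weighted average is the limit; taking the series as the definition makes the
  functional visibly the pairing with \<open>e_star\<close>.\<close>

definition W_lim :: "W \<Rightarrow> real" where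
  "W_lim x = (\<Sum>i. W_nth x i / 2 ^ Suc i)"

lemma W_nth_sums: "(\<lambda>i. W_nth x i / 2 ^ Suc i) sums W_lim x"
  unfolding W_lim_def W_nth_def by (rule summable_sums[OF summable_cseq_half])

lemma W_nth_tendsto: "W_nth x \<longlonglongrightarrow> W_lim x"
proof -
  have "lim (cseq_nth (W_cseq x)) = W_lim x"
    using W_cseq[of x] by (simp add: W_set_def W_lim_def W_nth_def)
  then show ?thesis
    using convergent_cseq_nth[of "W_cseq x"] by (simp add: W_nth_def[abs_def] convergent_LIMSEQ_iff)
qed

lemma linear_W_lim: "linear W_lim"
proof (rule linearI)
  fix x y r
  have "W_nth (x + y) \<longlonglongrightarrow> W_lim x + W_lim y"
    unfolding W_nth_simps(2)[abs_def] by (intro tendsto_add W_nth_tendsto)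
  then show "W_lim (x + y) = W_lim x + W_lim y"
    using W_nth_tendsto LIMSEQ_unique by blast
  have "W_nth (r *\<^sub>R x) \<longlonglongrightarrow> r *\<^sub>R W_lim x"
    unfolding W_nth_simps(5)[abs_def] real_scaleR_def by (intro tendsto_mult_left W_nth_tendsto)
  then show "W_lim (r *\<^sub>R x) = r *\<^sub>R W_lim x"
    using W_nth_tendsto LIMSEQ_unique by blast
qed

lemma W_lim_W_one: "W_lim W_one = 1"
  using W_nth_tendsto[of W_one] LIMSEQ_unique[OF _ tendsto_const[of 1]]
  by (simp add: W_nth_simps(6)[abs_def])

lemma W_exists:
  assumes "s \<longlonglongrightarrow> l" and "(\<lambda>i. s i / 2 ^ Suc i) sums l"
  obtains x where "W_nth x = s" "W_lim x = l"
proof -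
  have s: "cseq_nth (Cseq s) = s"
    using assms(1) by (auto intro!: Cseq_inverse convergentI)
  then have "Cseq s \<in> W_set"
    using assms by (simp add: W_set_def limI sums_unique)
  then have "W_nth (W_of_cseq (Cseq s)) = s"
    by (simp add: W_nth_def W_of_cseq_inverse s)
  moreover from this have "W_lim (W_of_cseq (Cseq s)) = l"
    using assms(2) by (simp add: W_lim_def sums_iff)
  ultimately show thesis by (rule that)
qed

lemma sum_half: "(\<Sum>i<N. 1 / 2 ^ Suc i :: real) = 1 - 1 / 2 ^ N"
  by (induction N) (simp_all add: field_simps)

lemma sums_half_tail: "(\<lambda>i. if i < N then 0 else t / 2 ^ Suc i :: real) sums (t / 2 ^ N)"
proof -
  have "(\<lambda>i. t * (1 / 2 ^ Suc i)) sums (t * 1)"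
    using summable_sums[OF summable_half] suminf_half by (intro sums_mult) simp
  then have "(\<lambda>i. t / 2 ^ Suc i) sums t" by simp
  moreover have "(\<lambda>i. if i \<in> {..<N} then t / 2 ^ Suc i else 0) sums (\<Sum>i<N. t / 2 ^ Suc i)"
    by (rule sums_If_finite_set) simp
  ultimately have "(\<lambda>i. t / 2 ^ Suc i - (if i \<in> {..<N} then t / 2 ^ Suc i else 0))
      sums (t - (\<Sum>i<N. t / 2 ^ Suc i))"
    by (rule sums_diff)
  moreover have "t - (\<Sum>i<N. t / 2 ^ Suc i) = t / 2 ^ N"
  proof -
    have "(\<Sum>i<N. t / 2 ^ Suc i) = t * (1 - 1 / 2 ^ N)"
      unfolding sum_half[symmetric] sum_distrib_left by simp
    then show ?thesis by (simp only: right_diff_distrib) simp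
  qed
  moreover have "(\<lambda>i. t / 2 ^ Suc i - (if i \<in> {..<N} then t / 2 ^ Suc i else 0))
      = (\<lambda>i. if i < N then 0 else t / 2 ^ Suc i)"
    by auto
  ultimately show ?thesis by (simp only:)
qed

text \<open>The weights before \<open>N\<close> add up to \<open>1 - 1 / 2 ^ N\<close>, so the constant tail \<open>t\<close> that the averaging
  condition forces is a normalised weighted mean of the given values and stays in \<open>[-1, 1]\<close>. At
  \<open>N = 0\<close> the condition leaves \<open>t\<close> undetermined, and the division by \<open>1 - 1 / 2 ^ N\<close> would be by 0.\<close>

lemma W_extension:
  assumes "N > 0" and s: "\<And>i. i < N \<Longrightarrow> \<bar>s i\<bar> \<le> 1"
  obtains x where "norm x \<le> 1" "\<And>i. i < N \<Longrightarrow> W_nth x i = s i"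
proof -
  define q :: real where "q = 1 / 2 ^ N"
  have q: "0 < q" "q < 1" using \<open>N > 0\<close> by (simp_all add: q_def)
  define a where "a = (\<Sum>i<N. s i / 2 ^ Suc i)"
  define t where "t = a / (1 - q)"
  have "\<bar>a\<bar> \<le> (\<Sum>i<N. 1 / 2 ^ Suc i)"
    unfolding a_def by (rule order_trans[OF sum_abs]) (auto intro!: sum_mono divide_right_mono s)
  then have "\<bar>a\<bar> \<le> 1 - q" using sum_half[of N] by (simp add: q_def)
  then have t: "\<bar>t\<bar> \<le> 1" using q by (simp add: t_def)
  define x where "x = (\<lambda>i. if i < N then s i else t)"
  have "x \<longlonglongrightarrow> t"
    by (rule tendsto_eventually) (auto simp: x_def eventually_sequentially intro!: exI[of _ N])
  moreover have "(\<lambda>i. x i / 2 ^ Suc i) sums t"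
  proof -
    have "(\<lambda>i. if i \<in> {..<N} then s i / 2 ^ Suc i else 0) sums a"
      unfolding a_def by (rule sums_If_finite_set) simp
    from sums_add[OF this sums_half_tail[of N t]]
    have "(\<lambda>i. x i / 2 ^ Suc i) sums (a + t / 2 ^ N)"
      by (rule back_subst[of "\<lambda>f. f sums _"]) (auto simp: x_def)
    moreover have "a + t / 2 ^ N = t"
      using q by (simp add: t_def field_simps flip: q_def) (simp add: q_def)
    ultimately show ?thesis by simp
  qed
  ultimately obtain w where w: "W_nth w = x" by (rule W_exists)
  show thesis
  proof (rule that[of w])
    show "norm w \<le> 1" by (rule W_norm_le) (use s t in \<open>auto simp: w x_def\<close>)
  qed (simp add: w x_def)
qed

section \<open>The dual of \<open>W\<close>\<close>

lemma summable_phi: "summable (\<lambda>j. W_nth x j * l1_nth y j)"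
  by (rule summable_comparison_test'[OF summable_mult[OF summable_abs_l1, of "norm x" y]])
    (simp add: abs_mult mult_right_mono abs_W_nth_le_norm)

lemma phi_sums: "(\<lambda>j. W_nth x j * l1_nth y j) sums phi y x"
  unfolding phi_apply by (rule summable_sums[OF summable_phi])

lemma linear_phi: "linear phi"
proof (rule linearI; rule blinfun_eqI)
  fix y z r x
  show "phi (y + z) x = (phi y + phi z) x"
    using sums_add[OF phi_sums phi_sums, of x y x z] phi_sums[of x "y + z"]
    by (simp add: blinfun.add_left sums_iff algebra_simps)
  show "phi (r *\<^sub>R y) x = (r *\<^sub>R phi y) x"
    using sums_mult[OF phi_sums, of r x y] phi_sums[of x "r *\<^sub>R y"]
    by (simp add: blinfun.scaleR_left sums_iff algebra_simps)
qed

lemma phi_le: "\<bar>phi y x\<bar> \<le> norm y * norm x"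
proof -
  have "norm (W_nth x j * l1_nth y j) \<le> norm x * \<bar>l1_nth y j\<bar>" for j
    by (simp add: abs_mult mult_right_mono abs_W_nth_le_norm)
  from norm_suminf_le[OF this summable_mult[OF summable_abs_l1]] show ?thesis
    by (simp add: phi_apply norm_l1_def suminf_mult[OF summable_abs_l1] mult.commute)
qed

lemma norm_phi: "norm (phi y) = norm y"
proof (rule antisym)
  show "norm (phi y) \<le> norm y"
    by (rule norm_blinfun_bound) (use phi_le in auto)
  have bound: "2 * (\<Sum>i<N. \<bar>l1_nth y i\<bar>) - norm y \<le> norm (phi y)" if "N > 0" for N
  proof -
    have "\<bar>sgn (l1_nth y i)\<bar> \<le> 1" for i by (simp add: sgn_if)
    then obtain x where x: "norm x \<le> 1" "\<And>i. i < N \<Longrightarrow> W_nth x i = sgn (l1_nth y i)"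
      using W_extension[OF \<open>N > 0\<close>, of "\<lambda>i. sgn (l1_nth y i)"] by metis
    \<comment> \<open>The tail of \<open>x\<close> is only known to lie in the ball, so it costs at most the tail of \<open>norm y\<close>.\<close>
    have ge: "W_nth x i * l1_nth y i \<ge> (if i \<in> {..<N} then 2 * \<bar>l1_nth y i\<bar> else 0) - \<bar>l1_nth y i\<bar>" for i
    proof (cases "i < N")
      case True
      then show ?thesis by (simp add: x abs_sgn mult.commute)
    next
      case False
      have "\<bar>W_nth x i * l1_nth y i\<bar> \<le> 1 * \<bar>l1_nth y i\<bar>"
        unfolding abs_mult using x(1) abs_W_nth_le_norm[of x i] by (intro mult_right_mono) auto
      then show ?thesis using False by auto
    qed
    have "(\<lambda>i. (if i \<in> {..<N} then 2 * \<bar>l1_nth y i\<bar> else 0) - \<bar>l1_nth y i\<bar>)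
        sums ((\<Sum>i<N. 2 * \<bar>l1_nth y i\<bar>) - norm y)"
      unfolding norm_l1_def
      by (intro sums_diff sums_If_finite_set summable_sums[OF summable_abs_l1]) simp
    from sums_le[OF ge this phi_sums] have "2 * (\<Sum>i<N. \<bar>l1_nth y i\<bar>) - norm y \<le> phi y x"
      by (simp add: sum_distrib_left)
    also have "\<dots> \<le> norm (phi y) * norm x"
      using norm_blinfun[of "phi y" x] by simp
    also have "\<dots> \<le> norm (phi y)"
      using x(1) by (simp add: mult_left_le)
    finally show ?thesis .
  qed
  have "(\<lambda>N. 2 * (\<Sum>i<N. \<bar>l1_nth y i\<bar>) - norm y) \<longlonglongrightarrow> 2 * norm y - norm y"
    unfolding norm_l1_def by (intro tendsto_intros summable_LIMSEQ summable_abs_l1)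
  then show "norm y \<le> norm (phi y)"
    by (intro LIMSEQ_le_const2[of "\<lambda>N. 2 * (\<Sum>i<N. \<bar>l1_nth y i\<bar>) - norm y"])
      (use bound in \<open>auto intro!: exI[of _ 1]\<close>)
qed

lemma inj_phi: "inj phi"
  unfolding linear_injective_0[OF linear_phi] using norm_phi by (metis norm_eq_zero)

lemma phi_basis: "phi (l1_basis n) x = W_nth x n"
proof -
  have "(\<lambda>j. if j \<in> {n} then W_nth x j else 0) sums (\<Sum>j\<in>{n}. W_nth x j)"
    by (rule sums_If_finite_set) simp
  moreover have "(\<lambda>j. if j \<in> {n} then W_nth x j else 0) = (\<lambda>j. W_nth x j * l1_nth (l1_basis n) j)"
    by (auto simp: l1_basis.rep_eq)
  ultimately have "(\<lambda>j. W_nth x j * l1_nth (l1_basis n) j) sums W_nth x n" by simp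
  then show ?thesis by (rule sums_unique2[OF phi_sums])
qed

lemma phi_e_star: "phi e_star x = W_lim x"
  using phi_sums[of x e_star] W_nth_sums[of x] by (simp add: e_star.rep_eq sums_iff)

text \<open>Coordinate 0 has weight \<open>1 / 2\<close>; subtracting \<open>2 / 2 ^ Suc i\<close> there cancels the contribution of the
  unit vector to the weighted average. For \<open>i = 0\<close> the result is the zero vector.\<close>

lemma W_unit_difference:
  obtains d where "W_lim d = 0"
    "\<And>j. W_nth d j = (if j = i then 1 else 0) - (if j = 0 then 2 / 2 ^ Suc i else 0)"
proof -
  define s :: "nat \<Rightarrow> real" where
    "s = (\<lambda>j. (if j = i then 1 else 0) - (if j = 0 then 2 / 2 ^ Suc i else 0))"
  have "s \<longlonglongrightarrow> 0"
    by (rule tendsto_eventually) (auto simp: s_def eventually_sequentially intro!: exI[of _ "Suc i"])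
  moreover have "(\<lambda>j. s j / 2 ^ Suc j) sums 0"
  proof -
    have "(\<lambda>j. (if j = i then 1 / 2 ^ Suc j else 0) - (if j = 0 then 2 / 2 ^ Suc i / 2 ^ Suc j else 0))
        sums (1 / 2 ^ Suc i - 2 / 2 ^ Suc i / 2 ^ Suc 0 :: real)"
      by (intro sums_diff sums_single)
    moreover have "(\<lambda>j. (if j = i then 1 / 2 ^ Suc j else 0) - (if j = 0 then 2 / 2 ^ Suc i / 2 ^ Suc j else 0))
        = (\<lambda>j. s j / 2 ^ Suc j)"
      by (auto simp: s_def diff_divide_distrib)
    ultimately show ?thesis by simp
  qed
  ultimately obtain d where "W_nth d = s" "W_lim d = 0" by (rule W_exists)
  then show thesis using that by (simp add: s_def)
qed

text \<open>The weights of all the other coordinates together equal that of coordinate 0, so a vanishing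
  average bounds coordinate 0 by the others.\<close>

lemma W_lim_zero_norm_le:
  assumes "W_lim x = 0" and b: "\<And>j. j > 0 \<Longrightarrow> \<bar>W_nth x j\<bar> \<le> b"
  shows "norm x \<le> b"
proof (rule W_norm_le)
  fix j
  have "(\<lambda>i. W_nth x (Suc i) / 2 ^ Suc (Suc i)) sums (0 - W_nth x 0 / 2 ^ Suc 0)"
    using W_nth_sums[of x] assms(1) by (subst sums_Suc_iff) simp
  moreover have half: "(\<lambda>i. (b / 2) * (1 / 2 ^ Suc i)) sums ((b / 2) * 1)"
    using summable_sums[OF summable_half] suminf_half by (intro sums_mult) simp
  moreover have "norm (W_nth x (Suc i) / 2 ^ Suc (Suc i)) \<le> (b / 2) * (1 / 2 ^ Suc i)" for i
    using b[of "Suc i"] by (simp add: field_simps)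
  ultimately have "norm (0 - W_nth x 0 / 2 ^ Suc 0) \<le> (b / 2) * 1"
    using norm_suminf_le[of "\<lambda>i. W_nth x (Suc i) / 2 ^ Suc (Suc i)" "\<lambda>i. (b / 2) * (1 / 2 ^ Suc i)"]
      sums_summable[OF half] by (simp only: sums_iff)
  then show "\<bar>W_nth x j\<bar> \<le> b" using b[of j] by (cases "j = 0") auto
qed

text \<open>The coefficients of the representing sequence are \<open>g i = f (d i)\<close>, except that \<open>f\<close> also sees the
  limit of \<open>x\<close>, with some coefficient \<open>a\<close>. On \<open>W\<close> the limit functional is itself \<open>e_star\<close>,
  so \<open>a *\<^sub>R e_star\<close> is added to the representing sequence.\<close>

lemma surj_phi: "surj phi"
  unfolding surj_def
proof
  fix f :: "W \<Rightarrow>\<^sub>L real"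
  have "\<exists>d. \<forall>i. W_lim (d i) = 0 \<and> (\<forall>j. W_nth (d i) j =
      (if j = i then 1 else 0) - (if j = 0 then 2 / 2 ^ Suc i else 0))"
    by (rule choice) (metis W_unit_difference)
  then obtain d where dl: "\<And>i. W_lim (d i) = 0" and
    d: "\<And>i j. W_nth (d i) j = (if j = i then 1 else 0) - (if j = 0 then 2 / 2 ^ Suc i else 0)"
    by blast
  define g where "g i = f (d i)" for i
  have lim_partial: "W_lim (\<Sum>i<N. c i *\<^sub>R d i) = 0" for N c
    using linear_sum[OF linear_W_lim, of "\<lambda>i. c i *\<^sub>R d i" "{..<N}"]
    by (simp add: linear_scale[OF linear_W_lim] dl)
  have partial: "W_nth (\<Sum>i<N. c i *\<^sub>R d i) j = (if j < N then c j else 0)" if "j > 0" for c N j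
  proof -
    have "W_nth (\<Sum>i<N. c i *\<^sub>R d i) j = (\<Sum>i<N. if j = i then c i else 0)"
      using that unfolding W_nth_sum W_nth_simps by (intro sum.cong) (simp_all add: d)
    then show ?thesis by simp
  qed
  have f_partial: "f (\<Sum>i<N. c i *\<^sub>R d i) = (\<Sum>i<N. c i * g i)" for c N
    by (simp add: blinfun.sum_right blinfun.scaleR_right g_def)
  \<comment> \<open>Partial sums with coefficients of modulus at most 1 stay in the unit ball.\<close>
  have "(\<Sum>i<N. \<bar>g i\<bar>) \<le> norm f" for N
  proof -
    let ?u = "\<Sum>i<N. sgn (g i) *\<^sub>R d i"
    have "norm ?u \<le> 1"
      by (rule W_lim_zero_norm_le[OF lim_partial], subst partial) (auto simp: sgn_if)
    have "(\<Sum>i<N. \<bar>g i\<bar>) = f ?u"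
      unfolding f_partial by (simp add: abs_sgn mult.commute)
    also have "\<dots> \<le> norm f * norm ?u" using norm_blinfun[of f ?u] by simp
    also have "\<dots> \<le> norm f" using \<open>norm ?u \<le> 1\<close> by (simp add: mult_left_le)
    finally show ?thesis .
  qed
  then have sm: "summable (\<lambda>i. \<bar>g i\<bar>)"
    by (intro summableI_nonneg_bounded[where x = "norm f"]) auto
  define a where "a = f W_one - (\<Sum>i. g i)"
  define y where "y = L1 g + a *\<^sub>R e_star"
  have y: "l1_nth y i = g i + a * (1 / 2 ^ Suc i)" for i
    using sm by (simp add: y_def L1_inverse e_star.rep_eq)
  have "phi y x = f x" for x
  proof -
    let ?L = "W_lim x"
    \<comment> \<open>The remainder of the expansion of \<open>x\<close>: coordinates \<open>0 < j < N\<close> vanish, the later ones are small.\<close>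
    define r where "r N = x - ?L *\<^sub>R W_one - (\<Sum>i<N. (W_nth x i - ?L) *\<^sub>R d i)" for N
    have rl: "W_lim (r N) = 0" for N
      by (simp add: W_lim_W_one r_def linear_diff[OF linear_W_lim] linear_scale[OF linear_W_lim] lim_partial)
    have rn: "W_nth (r N) j = (if j < N then 0 else W_nth x j - ?L)" if "j > 0" for N j
      unfolding r_def using partial[OF that, of "\<lambda>i. W_nth x i - ?L" N] by simp
    have "r \<longlonglongrightarrow> 0"
    proof (rule LIMSEQ_I)
      fix e :: real assume "e > 0"
      then obtain M where M: "\<And>j. j \<ge> M \<Longrightarrow> \<bar>W_nth x j - ?L\<bar> < e / 2"
        using LIMSEQ_D[OF W_nth_tendsto[of x], of "e / 2"] by auto
      have "norm (r N) \<le> e / 2" if "N \<ge> M" for N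
      proof (rule W_lim_zero_norm_le[OF rl])
        fix j :: nat assume "j > 0"
        then show "\<bar>W_nth (r N) j\<bar> \<le> e / 2"
          using M[of j] that \<open>e > 0\<close> by (simp add: rn less_imp_le)
      qed
      then show "\<exists>M. \<forall>N\<ge>M. norm (r N - 0) < e" using \<open>e > 0\<close>
        by (intro exI[of _ M]) fastforce
    qed
    then have "(\<lambda>N. f x - ?L * f W_one - f (r N)) \<longlonglongrightarrow> f x - ?L * f W_one - f 0"
      by (intro tendsto_intros)
    moreover have "f x - ?L * f W_one - f (r N) = (\<Sum>i<N. (W_nth x i - ?L) * g i)" for N
      by (simp add: r_def blinfun.diff_right blinfun.scaleR_right f_partial)
    ultimately have "(\<lambda>i. (W_nth x i - ?L) * g i) sums (f x - ?L * f W_one)"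
      by (simp add: sums_def)
    moreover have "(\<lambda>i. ?L * g i) sums (?L * (\<Sum>i. g i))"
      by (rule sums_mult[OF summable_sums[OF summable_rabs_cancel[OF sm]]])
    moreover have "(\<lambda>i. a * (W_nth x i / 2 ^ Suc i)) sums (a * ?L)"
      by (rule sums_mult[OF W_nth_sums])
    ultimately have "(\<lambda>i. (W_nth x i - ?L) * g i + ?L * g i + a * (W_nth x i / 2 ^ Suc i))
        sums (f x - ?L * f W_one + ?L * (\<Sum>i. g i) + a * ?L)"
      by (intro sums_add)
    moreover have "f x - ?L * f W_one + ?L * (\<Sum>i. g i) + a * ?L = f x"
      by (simp add: a_def algebra_simps)
    moreover have "(\<lambda>i. (W_nth x i - ?L) * g i + ?L * g i + a * (W_nth x i / 2 ^ Suc i))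
        = (\<lambda>i. W_nth x i * l1_nth y i)"
      unfolding y by (rule ext) (simp add: algebra_simps)
    ultimately have "(\<lambda>i. W_nth x i * l1_nth y i) sums f x" by (simp only:)
    then show ?thesis by (rule sums_unique2[OF phi_sums])
  qed
  then show "\<exists>y. f = phi y" by (intro exI[of _ y] blinfun_eqI) simp
qed

section \<open>Topologies pulled back from a product of lines\<close>

lemma limitin_pullback_topology:
  "limitin (pullback_topology UNIV f T) s l F \<longleftrightarrow> limitin T (f \<circ> s) (f l) F"
  unfolding limitin_def openin_pullback_topology topspace_pullback_topology by auto

lemma compactin_pullback_topology:
  assumes "compactin T (f ` S)"
  shows "compactin (pullback_topology UNIV f T) S"
  unfolding compactin_def
proof (intro conjI allI impI)
  show "S \<subseteq> topspace (pullback_topology UNIV f T)"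
    using compactin_subset_topspace[OF assms] by (auto simp: topspace_pullback_topology)
  fix \<U> assume \<U>: "Ball \<U> (openin (pullback_topology UNIV f T)) \<and> S \<subseteq> \<Union>\<U>"
  then obtain g where g: "\<And>U. U \<in> \<U> \<Longrightarrow> openin T (g U) \<and> U = f -` g U"
    unfolding openin_pullback_topology by simp metis
  have "f ` S \<subseteq> \<Union>(g ` \<U>)" using \<U> g by blast
  then obtain \<F> where \<F>: "finite \<F>" "\<F> \<subseteq> g ` \<U>" "f ` S \<subseteq> \<Union>\<F>"
    using assms g unfolding compactin_def by (metis (no_types, lifting) image_iff)
  then obtain \<G> where \<G>: "finite \<G>" "\<G> \<subseteq> \<U>" "\<F> = g ` \<G>"
    by (meson finite_subset_image)
  have "S \<subseteq> \<Union>\<G>" using \<F>(3) \<G> g by blast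
  then show "\<exists>\<F>. finite \<F> \<and> \<F> \<subseteq> \<U> \<and> S \<subseteq> \<Union>\<F>" using \<G> by blast
qed

text \<open>Continuity and separation are inherited coordinatewise from the product of lines. For local
  convexity, shrink a basic open box to a product of intervals around the point, whose preimage under
  a linear map is convex.\<close>

lemma locally_convex_pullback:
  fixes f :: "'a::real_vector \<Rightarrow> 'b \<Rightarrow> real"
  assumes add: "\<And>x y i. f (x + y) i = f x i + f y i"
    and scale: "\<And>r x i. f (r *\<^sub>R x) i = r * f x i"
    and inj: "inj f"
  shows "locally_convex_hausdorff (pullback_topology UNIV f euclidean)"
proof -
  let ?T = "pullback_topology UNIV f euclidean"
  have into: "continuous_map X ?T g" if "\<And>i. continuous_map X euclideanreal (\<lambda>x. f (g x) i)" for X :: "'z topology" and g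
  proof (rule continuous_map_pullback')
    show "continuous_map X euclidean (f \<circ> g)"
      unfolding euclidean_product_topology[symmetric] continuous_map_componentwise_UNIV
      using that by simp
  qed auto
  have outof: "continuous_map ?T euclideanreal (\<lambda>x. f x i)" for i
    using continuous_map_pullback[of euclidean euclidean "\<lambda>g. g i" UNIV f]
    by (simp add: o_def continuous_on_product_coordinates)
  have 1: "topspace ?T = UNIV" by (simp add: topspace_pullback_topology)
  have 2: "Hausdorff_space ?T"
  proof (rule Hausdorff_space_injective_preimage)
    show "Hausdorff_space (product_topology (\<lambda>i::'b. euclideanreal) UNIV)"
      by (simp add: Hausdorff_space_product_topology)
    show "continuous_map ?T (product_topology (\<lambda>i. euclideanreal) UNIV) f"
      unfolding continuous_map_componentwise_UNIV using outof by blast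
  qed (use inj in \<open>auto intro: inj_on_subset\<close>)
  have 3: "continuous_map (prod_topology ?T ?T) ?T (\<lambda>(x, y). x + y)"
  proof (rule into)
    fix i
    have "continuous_map (prod_topology ?T ?T) euclideanreal (\<lambda>p. f (fst p) i + f (snd p) i)"
      using continuous_map_compose[OF continuous_map_fst outof[of i], of ?T]
        continuous_map_compose[OF continuous_map_snd outof[of i], of ?T]
      by (intro continuous_map_add) (simp_all add: o_def)
    then show "continuous_map (prod_topology ?T ?T) euclideanreal (\<lambda>p. f (case p of (x, y) \<Rightarrow> x + y) i)"
      by (simp add: case_prod_unfold add)
  qed
  have 4: "continuous_map (prod_topology euclideanreal ?T) ?T (\<lambda>(r, x). r *\<^sub>R x)"
  proof (rule into)
    fix i
    have "continuous_map (prod_topology euclideanreal ?T) euclideanreal (\<lambda>p. fst p * f (snd p) i)"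
      using continuous_map_compose[OF continuous_map_snd outof[of i], of euclideanreal]
      by (intro continuous_map_real_mult continuous_map_fst) (simp add: o_def)
    then show "continuous_map (prod_topology euclideanreal ?T) euclideanreal (\<lambda>p. f (case p of (r, x) \<Rightarrow> r *\<^sub>R x) i)"
      by (simp add: case_prod_unfold scale)
  qed
  have 5: "neighbourhood_base_of convex ?T"
    unfolding neighbourhood_base_of
  proof (intro allI impI)
    fix W x assume "openin ?T W \<and> x \<in> W"
    then obtain U where U: "open U" "W = f -` U" "f x \<in> U"
      by (auto simp: openin_pullback_topology)
    then have "openin (product_topology (\<lambda>i. euclideanreal) UNIV) U"
      by (simp add: euclidean_product_topology)
    from product_topology_open_contains_basis[OF this U(3)] obtain X where
      X: "f x \<in> (\<Pi>\<^sub>E i\<in>UNIV. X i)" "\<And>i. open (X i)" "finite {i. X i \<noteq> UNIV}" "(\<Pi>\<^sub>E i\<in>UNIV. X i) \<subseteq> U"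
      by auto
    have "\<exists>e>0. ball (f x i) e \<subseteq> X i" for i
      using X(1,2) by (simp add: PiE_UNIV_domain Pi_iff open_contains_ball)
    then obtain e where e: "\<And>i. e i > 0" "\<And>i. ball (f x i) (e i) \<subseteq> X i" by metis
    define V where "V = {y. \<forall>i\<in>{i. X i \<noteq> UNIV}. f y i \<in> ball (f x i) (e i)}"
    have "openin ?T V"
    proof -
      have "open {g. \<forall>i\<in>{i. X i \<noteq> UNIV}. g i \<in> ball (f x i) (e i)}"
        by (rule product_topology_basis'[of _ _ "\<lambda>i. i"]) (use X(3) in auto)
      then show ?thesis
        unfolding openin_pullback_topology V_def by (intro exI conjI) auto
    qed
    moreover have "convex V"
      unfolding convex_alt
    proof (intro ballI allI impI)
      fix y z and u :: real assume "y \<in> V" "z \<in> V" and u: "0 \<le> u \<and> u \<le> 1"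
      then have "(1 - u) *\<^sub>R f y i + u *\<^sub>R f z i \<in> ball (f x i) (e i)" if "X i \<noteq> UNIV" for i
        using convexD_alt[OF convex_ball, of "f y i" "f x i" "e i" "f z i" u] that
        by (auto simp: V_def)
      then show "(1 - u) *\<^sub>R y + u *\<^sub>R z \<in> V" by (simp add: V_def add scale)
    qed
    moreover have "x \<in> V" using e(1) by (simp add: V_def)
    moreover have "V \<subseteq> W"
    proof
      fix y assume y: "y \<in> V"
      have "f y i \<in> X i" for i
      proof (cases "X i = UNIV")
        case False
        then have "f y i \<in> ball (f x i) (e i)" using y by (simp add: V_def)
        then show ?thesis using e(2) by blast
      qed simp
      then have "f y \<in> U" using X(4) by (auto simp: PiE_UNIV_domain)
      then show "y \<in> W" by (simp add: U(2))
    qed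
    ultimately show "\<exists>U V. openin ?T U \<and> convex V \<and> x \<in> U \<and> U \<subseteq> V \<and> V \<subseteq> W" by blast
  qed
  show ?thesis unfolding locally_convex_hausdorff_def using 1 2 3 4 5 by blast
qed

text \<open>The two nested pullbacks collapse into the topology of pointwise convergence on \<open>W\<close>.\<close>

lemma sigma_l1_W_eq: "sigma_l1_W = pullback_topology UNIV (\<lambda>y. blinfun_apply (phi y)) euclidean"
proof -
  have "phi -` (blinfun_apply -` U) = (\<lambda>y. blinfun_apply (phi y)) -` U" for U by auto
  then show ?thesis
    unfolding topology_eq sigma_l1_W_def strong_operator_topology_def openin_pullback_topology Int_UNIV_right
    by metis
qed

lemma limitin_sigma_l1_W:
  "limitin sigma_l1_W s l F \<longleftrightarrow> (\<forall>x. ((\<lambda>n. phi (s n) x) \<longlongrightarrow> phi l x) F)"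
  unfolding sigma_l1_W_eq limitin_pullback_topology euclidean_product_topology[symmetric]
    limitin_componentwise by (simp add: o_def)

lemma limitin_l1_basis: "limitin sigma_l1_W l1_basis e_star sequentially"
  unfolding limitin_sigma_l1_W phi_basis phi_e_star using W_nth_tendsto by blast

lemma locally_convex_sigma: "locally_convex_hausdorff sigma_l1_W"
  unfolding sigma_l1_W_eq
proof (rule locally_convex_pullback)
  show "inj (\<lambda>y. blinfun_apply (phi y))"
    using inj_phi by (auto simp: inj_def blinfun_apply_inject)
qed (simp_all add: linear_add[OF linear_phi] linear_scale[OF linear_phi] blinfun.add_left blinfun.scaleR_left)

section \<open>The face \<open>K_set\<close>\<close>

lemma norm_l1_le_iff: "norm y \<le> 1 \<longleftrightarrow> (\<forall>x. \<bar>phi y x\<bar> \<le> norm x)"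
proof
  assume "norm y \<le> 1"
  then show "\<forall>x. \<bar>phi y x\<bar> \<le> norm x"
    using phi_le[of y] by (meson mult_left_le_one_le norm_ge_zero order_trans)
next
  assume "\<forall>x. \<bar>phi y x\<bar> \<le> norm x"
  then have "norm (phi y) \<le> 1" by (intro norm_blinfun_bound) auto
  then show "norm y \<le> 1" by (simp add: norm_phi)
qed

lemma phi_W_one: "l1_nth y sums phi y W_one"
  using phi_sums[of W_one y] by simp

lemma norm_l1_eq_if_nonneg:
  assumes "\<And>i. l1_nth y i \<ge> 0"
  shows "norm y = phi y W_one"
  using phi_W_one[of y] assms by (simp add: norm_l1_def sums_iff)

text \<open>Positivity of a single coordinate is not a weak-star closed condition, since the unit vectors are
  not in \<open>W\<close>. But total mass 1 together with norm at most 1 forces it: the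
  series of \<open>\<bar>y i\<bar> - y i\<close> has nonnegative terms and sum at most 0.\<close>

lemma K_set_iff: "y \<in> K_set \<longleftrightarrow> phi y W_one = 1 \<and> norm y \<le> 1"
proof
  assume "y \<in> K_set"
  then show "phi y W_one = 1 \<and> norm y \<le> 1"
    using phi_W_one[of y] norm_l1_eq_if_nonneg[of y] by (simp add: K_set_def sums_iff)
next
  assume y: "phi y W_one = 1 \<and> norm y \<le> 1"
  have s: "(\<lambda>i. \<bar>l1_nth y i\<bar> - l1_nth y i) sums (norm y - 1)"
    using y phi_W_one[of y] summable_sums[OF summable_abs_l1[of y]]
    by (metis norm_l1_def sums_diff)
  have "norm y - 1 \<ge> 0"
    by (rule sums_le[OF _ sums_zero s]) simp
  then have "norm y - 1 = 0" using y by simp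
  then have "\<forall>i. \<bar>l1_nth y i\<bar> - l1_nth y i = 0"
    using s by (subst suminf_eq_zero_iff[symmetric]) (simp_all add: sums_iff)
  then have "l1_nth y i \<ge> 0" for i by (metis abs_ge_zero eq_iff_diff_eq_0)
  then show "y \<in> K_set" using y phi_W_one[of y] by (simp add: K_set_def sums_iff)
qed

lemma l1_basis_in_K: "l1_basis n \<in> K_set"
proof -
  have "phi (l1_basis n) W_one = 1" by (simp add: phi_basis)
  moreover have "norm (l1_basis n) = phi (l1_basis n) W_one"
    by (rule norm_l1_eq_if_nonneg) (simp add: l1_basis.rep_eq)
  ultimately show ?thesis by (simp add: K_set_iff)
qed

lemma e_star_in_K: "e_star \<in> K_set"
  using suminf_half by (simp add: K_set_def e_star.rep_eq)

text \<open>The image of \<open>K_set\<close> in the space of all functions on \<open>W\<close>, with linearity spelled out by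
  pointwise equations so that closedness can be read off.\<close>

definition state_functionals :: "(W \<Rightarrow> real) set" where
  "state_functionals = {g. g W_one = 1 \<and> (\<forall>x. \<bar>g x\<bar> \<le> norm x) \<and>
    (\<forall>x y. g (x + y) = g x + g y) \<and> (\<forall>r x. g (r *\<^sub>R x) = r * g x)}"

lemma K_set_vimage: "K_set = (\<lambda>y. blinfun_apply (phi y)) -` state_functionals"
  by (auto simp: K_set_iff norm_l1_le_iff state_functionals_def blinfun.add_right blinfun.scaleR_right)

lemma K_set_image: "(\<lambda>y. blinfun_apply (phi y)) ` K_set = state_functionals"
proof (intro equalityI subsetI)
  fix g assume g: "g \<in> state_functionals"
  then have "bounded_linear g"
    by (intro bounded_linear_intro[of g 1]) (auto simp: state_functionals_def)
  then have "blinfun_apply (Blinfun g) = g" by (rule bounded_linear_Blinfun_apply)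
  moreover obtain y where "phi y = Blinfun g" using surj_phi by (metis surjD)
  ultimately have "blinfun_apply (phi y) = g" by simp
  then show "g \<in> (\<lambda>y. blinfun_apply (phi y)) ` K_set" using g unfolding K_set_vimage by blast
qed (auto simp: K_set_vimage)

lemma closed_state_functionals: "closed state_functionals"
  unfolding state_functionals_def
  by (intro closed_Collect_conj closed_Collect_all closed_Collect_eq closed_Collect_le
      continuous_intros continuous_on_product_coordinates)

text \<open>The argument of the Banach-Alaoglu theorem: a closed subset of a product of compact intervals.\<close>

lemma compact_state_functionals: "compact state_functionals"
proof -
  have "compactin (product_topology (\<lambda>x::W. euclideanreal) UNIV) (PiE UNIV (\<lambda>x. {- norm x..norm x}))"
    unfolding compactin_PiE by auto
  then have "compact (PiE UNIV (\<lambda>x::W. {- norm x..norm x}))"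
    by (simp add: euclidean_product_topology)
  then have "compact (PiE UNIV (\<lambda>x::W. {- norm x..norm x}) \<inter> state_functionals)"
    by (rule compact_Int_closed) (rule closed_state_functionals)
  moreover have "PiE UNIV (\<lambda>x::W. {- norm x..norm x}) \<inter> state_functionals = state_functionals"
    by (auto simp: state_functionals_def abs_le_iff minus_le_iff)
  ultimately show ?thesis by simp
qed

lemma compactin_K: "compactin sigma_l1_W K_set"
  unfolding sigma_l1_W_eq
  by (rule compactin_pullback_topology) (simp add: K_set_image compact_state_functionals)

lemma closedin_K: "closedin sigma_l1_W K_set"
  using compactin_imp_closedin[OF _ compactin_K] locally_convex_sigma
  by (simp add: locally_convex_hausdorff_def)

text \<open>The number 1 is an extreme point of the half-line below it; this drives both the face property of
  \<open>K_set\<close> and the extremality of \<open>W_one\<close>.\<close>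

lemma convex_comb_eq_1D:
  fixes a b u :: real
  assumes "(1 - u) * a + u * b = 1" "0 < u" "u < 1" "a \<le> 1" "b \<le> 1"
  shows "a = 1" "b = 1"
proof -
  have "(1 - u) * (1 - a) + u * (1 - b) = 0" using assms(1) by (simp add: algebra_simps)
  moreover have "(1 - u) * (1 - a) \<ge> 0" "u * (1 - b) \<ge> 0" using assms by simp_all
  ultimately have "(1 - u) * (1 - a) = 0" "u * (1 - b) = 0" by linarith+
  then show "a = 1" "b = 1" using assms by simp_all
qed

lemma phi_add: "phi (y + z) x = phi y x + phi z x"
  by (simp add: linear_add[OF linear_phi] blinfun.add_left)

lemma phi_scaleR: "phi (r *\<^sub>R y) x = r * phi y x"
  by (simp add: linear_scale[OF linear_phi] blinfun.scaleR_left)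

lemma convex_K: "convex K_set"
proof -
  have eq: "K_set = (\<lambda>y. phi y W_one) -` {1} \<inter> cball 0 1" by (auto simp: K_set_iff)
  have "linear (\<lambda>y. phi y W_one)" by (rule linearI) (simp_all add: phi_add phi_scaleR)
  then have "convex ((\<lambda>y. phi y W_one) -` {1})" by (rule convex_linear_vimage[OF _ convex_singleton])
  then show ?thesis unfolding eq by (rule convex_Int[OF _ convex_cball])
qed

lemma face_K: "K_set face_of cball 0 1"
  unfolding face_of_def
proof (intro conjI ballI impI)
  show "K_set \<subseteq> cball 0 1" by (auto simp: K_set_iff)
  fix a b x assume ab: "a \<in> cball 0 (1::real)" "b \<in> cball 0 (1::real)" and x: "x \<in> K_set" "x \<in> open_segment a b"
  obtain u where u: "0 < u" "u < 1" "x = (1 - u) *\<^sub>R a + u *\<^sub>R b"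
    using x(2) by (auto simp: in_segment)
  have le: "phi y W_one \<le> 1" if "y \<in> cball 0 (1::real)" for y
    using phi_le[of y W_one] that by (simp add: norm_W_one)
  have "(1 - u) * phi a W_one + u * phi b W_one = 1"
    using x(1) u(3) by (simp add: K_set_iff phi_add phi_scaleR)
  from convex_comb_eq_1D[OF this u(1,2) le[OF ab(1)] le[OF ab(2)]]
  show "a \<in> K_set" "b \<in> K_set" using ab by (auto simp: K_set_iff)
qed (rule convex_K)

lemma K_ne_cball: "K_set \<noteq> cball 0 1"
proof -
  have "0 \<notin> K_set" by (simp add: K_set_def)
  then show ?thesis by auto
qed

lemma infinite_dim_K: "\<not> finite_dim (affine hull K_set)"
proof
  assume "finite_dim (affine hull K_set)"
  then obtain B where B: "finite B" "affine hull K_set \<subseteq> span B" by (auto simp: finite_dim_def)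
  have "range l1_basis \<subseteq> span B"
    using l1_basis_in_K hull_subset[of K_set affine] B(2) by blast
  moreover have "independent (range l1_basis)"
    unfolding dependent_def
  proof
    assume "\<exists>a\<in>range l1_basis. a \<in> span (range l1_basis - {a})"
    then obtain n where n: "l1_basis n \<in> span (range l1_basis - {l1_basis n})" by blast
    have "subspace {y. l1_nth y n = 0}" by (rule subspaceI) simp_all
    moreover have "range l1_basis - {l1_basis n} \<subseteq> {y. l1_nth y n = 0}"
      by (auto simp: l1_basis.rep_eq)
    ultimately have "span (range l1_basis - {l1_basis n}) \<subseteq> {y. l1_nth y n = 0}"
      by (intro span_minimal)
    then show False using n by (auto simp: l1_basis.rep_eq)
  qed
  ultimately have "finite (range l1_basis)" using independent_span_bound B(1) by blast
  moreover have "inj l1_basis"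
    by (rule injI) (metis l1_basis.rep_eq zero_neq_one)
  ultimately show False using finite_imageD infinite_UNIV_nat by blast
qed

section \<open>The extreme point \<open>W_one\<close> and the Choquet simplex \<open>K_set\<close>\<close>

lemma extreme_W_one: "W_one extreme_point_of cball 0 1"
  unfolding extreme_point_of_def
proof (intro conjI ballI notI)
  show "W_one \<in> cball 0 1" by (simp add: norm_W_one)
  fix a b assume ab: "a \<in> cball 0 (1::real)" "b \<in> cball 0 (1::real)" and "W_one \<in> open_segment a b"
  then obtain u where u: "a \<noteq> b" "0 < u" "u < 1" "W_one = (1 - u) *\<^sub>R a + u *\<^sub>R b"
    by (auto simp: in_segment)
  have le: "W_nth y i \<le> 1" if "y \<in> cball 0 (1::real)" for y i
    using abs_W_nth_le_norm[of y i] that by simp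
  have "W_nth a i = W_nth b i" for i
  proof -
    have "(1 - u) * W_nth a i + u * W_nth b i = 1"
      using arg_cong[OF u(4), of "\<lambda>x. W_nth x i"] by simp
    from convex_comb_eq_1D[OF this u(2,3) le[OF ab(1)] le[OF ab(2)]] show ?thesis by simp
  qed
  then show False using W_eqI u(1) by blast
qed

lemma l1_max:
  obtains w where "\<And>i. l1_nth w i = max (l1_nth u i) (l1_nth v i)"
proof
  have "summable (\<lambda>i. \<bar>max (l1_nth u i) (l1_nth v i)\<bar>)"
    by (rule summable_comparison_test'[OF summable_add[OF summable_abs_l1[of u] summable_abs_l1[of v]]])
      (auto simp: max_def)
  then show "l1_nth (L1 (\<lambda>i. max (l1_nth u i) (l1_nth v i))) i = max (l1_nth u i) (l1_nth v i)" for i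
    by (simp add: L1_inverse)
qed

text \<open>The height of a point over \<open>K_set\<close> is its total mass, so forgetting the height identifies the
  cone with the positive cone of \<open>\<ell>\<^sub>1\<close>.\<close>

lemma base_cone_K: "base_cone K_set = {(p, phi p W_one) | p. \<forall>i. l1_nth p i \<ge> 0}"
proof (intro equalityI subsetI)
  fix q assume "q \<in> base_cone K_set"
  then obtain t k where tk: "q = t *\<^sub>R (k, 1)" "t \<ge> 0" "k \<in> K_set" by (auto simp: base_cone_def)
  have "\<forall>i. l1_nth (t *\<^sub>R k) i \<ge> 0" using tk by (simp add: K_set_def)
  moreover have "q = (t *\<^sub>R k, phi (t *\<^sub>R k) W_one)" using tk by (simp add: phi_scaleR K_set_iff)
  ultimately show "q \<in> {(p, phi p W_one) | p. \<forall>i. l1_nth p i \<ge> 0}" by blast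
next
  fix q assume "q \<in> {(p, phi p W_one) | p. \<forall>i. l1_nth p i \<ge> 0}"
  then obtain p where p: "q = (p, phi p W_one)" "\<And>i. l1_nth p i \<ge> 0" by blast
  have n: "norm p = phi p W_one" using p(2) by (rule norm_l1_eq_if_nonneg)
  show "q \<in> base_cone K_set"
  proof (cases "p = 0")
    case True
    then have "q = 0 *\<^sub>R (l1_basis 0, 1)" using p(1) n by (simp add: zero_prod_def)
    then show ?thesis using l1_basis_in_K[of 0] unfolding base_cone_def by force
  next
    case False
    then have "p /\<^sub>R norm p \<in> K_set" by (simp add: K_set_iff phi_scaleR flip: n)
    moreover have "q = norm p *\<^sub>R (p /\<^sub>R norm p, 1)" using p(1) False by (simp flip: n)
    ultimately show ?thesis unfolding base_cone_def using norm_ge_zero[of p] by blast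
  qed
qed

text \<open>Under the identification of \<open>base_cone_K\<close> the difference space is the graph of the total mass
  over \<open>\<ell>\<^sub>1\<close>, and least upper bounds are pointwise maxima.\<close>

lemma lattice_cone_K: "lattice_cone (base_cone K_set)"
proof -
  let ?P = "base_cone K_set"
  let ?g = "\<lambda>u. (u, phi u W_one)"
  have sub: "?g u - ?g v = ?g (u - v)" for u v
    by (simp add: linear_diff[OF linear_phi] blinfun.diff_left)
  have mem: "?g u \<in> ?P \<longleftrightarrow> (\<forall>i. l1_nth u i \<ge> 0)" for u
    unfolding base_cone_K by auto
  have D: "{p - q | p q. p \<in> ?P \<and> q \<in> ?P} = range ?g"
  proof (intro equalityI subsetI)
    fix r assume "r \<in> {p - q | p q. p \<in> ?P \<and> q \<in> ?P}"
    then show "r \<in> range ?g" unfolding base_cone_K using sub by auto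
  next
    fix r assume "r \<in> range ?g"
    then obtain u where u: "r = ?g u" by blast
    obtain p where p: "\<And>i. l1_nth p i = max (l1_nth u i) (l1_nth 0 i)" using l1_max by blast
    have "r = ?g p - ?g (p - u)" unfolding u sub by simp
    moreover have "?g p \<in> ?P" "?g (p - u) \<in> ?P" unfolding mem by (auto simp: p)
    ultimately show "r \<in> {p - q | p q. p \<in> ?P \<and> q \<in> ?P}" by blast
  qed
  have "\<exists>w\<in>range ?g. w - ?g u \<in> ?P \<and> w - ?g v \<in> ?P \<and>
      (\<forall>z\<in>range ?g. z - ?g u \<in> ?P \<and> z - ?g v \<in> ?P \<longrightarrow> z - w \<in> ?P)" for u v
  proof -
    obtain w where w: "\<And>i. l1_nth w i = max (l1_nth u i) (l1_nth v i)" using l1_max by blast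
    show ?thesis
      by (rule bexI[of _ "?g w"]) (auto simp only: sub mem w minus_l1.rep_eq, auto simp: max_def)
  qed
  then show ?thesis unfolding lattice_cone_def D Let_def by blast
qed

lemma choquet_K: "choquet_simplex sigma_l1_W K_set"
  unfolding choquet_simplex_def
  by (intro conjI locally_convex_sigma convex_K compactin_K lattice_cone_K)

section \<open>\<open>W\<close> as the space of continuous affine functions on \<open>K_set\<close>\<close>

text \<open>Conditioning a probability vector on avoiding \<open>n\<close>. If all the mass sits at \<open>n\<close>, any \<open>r'\<close> will do.\<close>

lemma K_set_split:
  assumes r: "r \<in> K_set"
  obtains r' where "r' \<in> K_set" "r = l1_nth r n *\<^sub>R l1_basis n + (1 - l1_nth r n) *\<^sub>R r'"
    "l1_nth r n \<le> 1"
proof -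
  define q where "q = r - l1_nth r n *\<^sub>R l1_basis n"
  have "l1_nth q i \<ge> 0" for i using r by (simp add: q_def l1_basis.rep_eq K_set_def)
  then have n: "norm q = phi q W_one" by (rule norm_l1_eq_if_nonneg)
  have s: "phi q W_one = 1 - l1_nth r n"
    using r by (simp add: q_def linear_diff[OF linear_phi] blinfun.diff_left phi_scaleR phi_basis K_set_iff)
  have le: "l1_nth r n \<le> 1" using n s norm_ge_zero[of q] by simp
  show thesis
  proof (cases "l1_nth r n = 1")
    case True
    then have "q = 0" using n s by simp
    then show thesis using that[of r] r True by (simp add: q_def)
  next
    case False
    let ?c = "1 - l1_nth r n"
    have "?c > 0" using False le by simp
    then have "q /\<^sub>R ?c \<in> K_set" by (simp add: K_set_iff phi_scaleR n s)
    moreover have "r = l1_nth r n *\<^sub>R l1_basis n + ?c *\<^sub>R (q /\<^sub>R ?c)"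
      using False by (simp add: q_def)
    ultimately show thesis using that le by blast
  qed
qed

text \<open>After \<open>N\<close> splittings the part of \<open>k\<close> beyond \<open>N\<close> has mass \<open>1 - (\<Sum>i<N. k i)\<close> and is carried by one
  point \<open>r\<close> of \<open>K_set\<close>. The contribution of \<open>f r\<close> tends to 0, because \<open>f\<close> is bounded on the compact set
  \<open>K_set\<close>.\<close>

lemma affine_cont_expansion:
  assumes f: "f \<in> affine_cont sigma_l1_W K_set" and k: "k \<in> K_set"
  shows "(\<lambda>i. l1_nth k i * f (l1_basis i)) sums f k"
proof -
  have aff: "f ((1 - t) *\<^sub>R x + t *\<^sub>R y) = (1 - t) * f x + t * f y"
    if "x \<in> K_set" "y \<in> K_set" "0 \<le> t" "t \<le> 1" for x y t
    using f that by (auto simp: affine_cont_def)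
  have "compactin (subtopology sigma_l1_W K_set) K_set"
    using compactin_K by (simp add: compactin_subtopology)
  then have "compact (f ` K_set)"
    using f image_compactin[of "subtopology sigma_l1_W K_set" K_set euclideanreal f]
    by (simp add: affine_cont_def)
  then have "\<exists>C. \<forall>r\<in>K_set. \<bar>f r\<bar> \<le> C"
    by (auto dest!: compact_imp_bounded simp: bounded_iff)
  then obtain C where C: "\<And>r. r \<in> K_set \<Longrightarrow> \<bar>f r\<bar> \<le> C" by blast
  let ?s = "\<lambda>N. \<Sum>i<N. l1_nth k i"
  have step: "\<exists>r\<in>K_set. (\<forall>i\<ge>N. (1 - ?s N) * l1_nth r i = l1_nth k i) \<and>
      f k = (\<Sum>i<N. l1_nth k i * f (l1_basis i)) + (1 - ?s N) * f r" for N
  proof (induction N)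
    case 0
    then show ?case using k by (intro bexI[of _ k]) auto
  next
    case (Suc N)
    then obtain r where r: "r \<in> K_set" "\<And>i. i \<ge> N \<Longrightarrow> (1 - ?s N) * l1_nth r i = l1_nth k i"
      "f k = (\<Sum>i<N. l1_nth k i * f (l1_basis i)) + (1 - ?s N) * f r" by blast
    obtain r' where r': "r' \<in> K_set" "r = l1_nth r N *\<^sub>R l1_basis N + (1 - l1_nth r N) *\<^sub>R r'"
      "l1_nth r N \<le> 1"
      using K_set_split[OF r(1)] by metis
    have r0: "l1_nth r N \<ge> 0" using r(1) by (simp add: K_set_def)
    have factor: "(1 - ?s N) * (1 - l1_nth r N) = 1 - ?s (Suc N)"
      using r(2)[of N] by (simp add: algebra_simps)
    have "(1 - ?s (Suc N)) * l1_nth r' i = l1_nth k i" if "i \<ge> Suc N" for i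
    proof -
      have "l1_nth r i = (1 - l1_nth r N) * l1_nth r' i"
        using arg_cong[OF r'(2), of "\<lambda>y. l1_nth y i"] that by (simp add: l1_basis.rep_eq)
      then show ?thesis using r(2)[of i] that unfolding factor[symmetric] by simp
    qed
    moreover have "f k = (\<Sum>i<Suc N. l1_nth k i * f (l1_basis i)) + (1 - ?s (Suc N)) * f r'"
    proof -
      have fr: "f r = l1_nth r N * f (l1_basis N) + (1 - l1_nth r N) * f r'"
        using aff[OF l1_basis_in_K r'(1), of "1 - l1_nth r N" N] r0 r'(2,3) by simp
      have "(1 - ?s N) * f r = ((1 - ?s N) * l1_nth r N) * f (l1_basis N)
          + ((1 - ?s N) * (1 - l1_nth r N)) * f r'"
        unfolding fr by (simp only: distrib_left mult.assoc)
      then have "(1 - ?s N) * f r = l1_nth k N * f (l1_basis N) + (1 - ?s (Suc N)) * f r'"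
        by (simp only: r(2)[OF order_refl] factor)
      then show ?thesis unfolding r(3) by simp
    qed
    ultimately show ?case using r'(1) by blast
  qed
  have "(\<lambda>N. f k - (\<Sum>i<N. l1_nth k i * f (l1_basis i))) \<longlonglongrightarrow> 0"
  proof (rule Lim_null_comparison)
    have "?s \<longlonglongrightarrow> 1"
      using phi_W_one[of k] k by (simp add: sums_def K_set_iff)
    then have "(\<lambda>N. \<bar>1 - ?s N\<bar> * C) \<longlonglongrightarrow> \<bar>1 - 1\<bar> * C" by (intro tendsto_intros)
    then show "(\<lambda>N. \<bar>1 - ?s N\<bar> * C) \<longlonglongrightarrow> 0" by simp
    show "\<forall>\<^sub>F N in sequentially. norm (f k - (\<Sum>i<N. l1_nth k i * f (l1_basis i))) \<le> \<bar>1 - ?s N\<bar> * C"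
    proof (rule always_eventually, rule allI)
      fix N
      obtain r where "r \<in> K_set" "f k - (\<Sum>i<N. l1_nth k i * f (l1_basis i)) = (1 - ?s N) * f r"
        using step[of N] by fastforce
      then show "norm (f k - (\<Sum>i<N. l1_nth k i * f (l1_basis i))) \<le> \<bar>1 - ?s N\<bar> * C"
        using C by (simp add: abs_mult mult_left_mono)
    qed
  qed
  from tendsto_diff[OF tendsto_const[of "f k"] this] show ?thesis by (simp add: sums_def)
qed

lemma continuous_map_sigma_phi: "continuous_map sigma_l1_W euclideanreal (\<lambda>y. phi y x)"
  unfolding sigma_l1_W_eq
  using continuous_map_pullback[of euclidean euclidean "\<lambda>g. g x" UNIV "\<lambda>y. blinfun_apply (phi y)"]
  by (simp add: o_def continuous_on_product_coordinates)

text \<open>The unit vectors lie in \<open>K_set\<close> and evaluate the coordinates of \<open>x\<close>.\<close>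

lemma sup_norm_on_K: "sup_norm_on K_set (\<lambda>k\<in>K_set. phi k x) = norm x"
proof -
  have le: "\<bar>phi k x\<bar> \<le> norm x" if "k \<in> K_set" for k
    using that by (simp add: K_set_iff norm_l1_le_iff)
  have eq: "sup_norm_on K_set (\<lambda>k\<in>K_set. phi k x) = (SUP k\<in>K_set. \<bar>phi k x\<bar>)"
    unfolding sup_norm_on_def by (intro SUP_cong) auto
  show ?thesis unfolding eq
  proof (rule antisym)
    show "(SUP k\<in>K_set. \<bar>phi k x\<bar>) \<le> norm x"
      using l1_basis_in_K le by (intro cSUP_least) auto
    show "norm x \<le> (SUP k\<in>K_set. \<bar>phi k x\<bar>)"
    proof (rule W_norm_le)
      fix i
      have "\<bar>phi (l1_basis i) x\<bar> \<le> (SUP k\<in>K_set. \<bar>phi k x\<bar>)"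
        by (intro cSUP_upper l1_basis_in_K bdd_aboveI2[of _ _ "norm x"] le)
      then show "\<bar>W_nth x i\<bar> \<le> (SUP k\<in>K_set. \<bar>phi k x\<bar>)" by (simp add: phi_basis)
    qed
  qed
qed

text \<open>Each \<open>x\<close> acts on \<open>K_set\<close> by duality. Conversely \<open>f\<close> comes from the sequence of its values at the
  unit vectors, which converges to \<open>f e_star\<close> by continuity and has weighted average \<open>f e_star\<close> by
  \<open>affine_cont_expansion\<close>; the agreement of the two is the membership in \<open>W\<close>.\<close>

lemma isometric_AK: "isometric_to_affine_cont TYPE(W) sigma_l1_W K_set"
  unfolding isometric_to_affine_cont_def
proof (intro exI[of _ "\<lambda>x. \<lambda>k\<in>K_set. phi k x"] conjI allI ballI)
  show "range (\<lambda>x. \<lambda>k\<in>K_set. phi k x) = affine_cont sigma_l1_W K_set"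
  proof (intro equalityI subsetI)
    fix f assume "f \<in> range (\<lambda>x. \<lambda>k\<in>K_set. phi k x)"
    then obtain x where x: "f = (\<lambda>k\<in>K_set. phi k x)" by blast
    have "continuous_map (subtopology sigma_l1_W K_set) euclideanreal f"
      using continuous_map_from_subtopology[OF continuous_map_sigma_phi[of x]]
      by (rule continuous_map_eq) (auto simp: x)
    then show "f \<in> affine_cont sigma_l1_W K_set"
      unfolding affine_cont_def using convexD_alt[OF convex_K]
      by (simp add: x phi_add phi_scaleR)
  next
    fix f assume f: "f \<in> affine_cont sigma_l1_W K_set"
    have "limitin (subtopology sigma_l1_W K_set) l1_basis e_star sequentially"
      unfolding limitin_subtopology using limitin_l1_basis l1_basis_in_K e_star_in_K by simp
    then have "limitin euclideanreal (f \<circ> l1_basis) (f e_star) sequentially"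
      by (rule continuous_map_limit[rotated]) (use f in \<open>simp add: affine_cont_def\<close>)
    then have "(\<lambda>n. f (l1_basis n)) \<longlonglongrightarrow> f e_star" by (simp add: o_def)
    moreover have "(\<lambda>n. f (l1_basis n) / 2 ^ Suc n) sums f e_star"
      using affine_cont_expansion[OF f e_star_in_K] by (simp add: e_star.rep_eq)
    ultimately obtain x where x: "W_nth x = (\<lambda>n. f (l1_basis n))" by (rule W_exists)
    have "f = (\<lambda>k\<in>K_set. phi k x)"
    proof (rule extensionalityI[of _ K_set])
      fix k assume k: "k \<in> K_set"
      have "(\<lambda>i. W_nth x i * l1_nth k i) sums f k"
        using affine_cont_expansion[OF f k] by (simp add: x mult.commute)
      then show "f k = (\<lambda>k\<in>K_set. phi k x) k"
        using sums_unique2[OF phi_sums] k by simp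
    qed (use f in \<open>simp_all add: affine_cont_def\<close>)
    then show "f \<in> range (\<lambda>x. \<lambda>k\<in>K_set. phi k x)" by blast
  qed
qed (simp_all add: blinfun.add_right blinfun.scaleR_right sup_norm_on_K)

section \<open>Polytopes in spaces without a Euclidean structure\<close>

text \<open>A vertex is a point at which the active constraints pin down the point within \<open>S\<close>. A vertex is thus
  determined by its set of active constraints, so there are finitely many. From any other point one
  can move both ways along a line on which the active constraints stay active, until a new one becomes
  active; the separation hypothesis guarantees that this happens in both directions. Induction on the
  number of inactive constraints puts every point in the hull of the vertices. No dimension occurs in
  this argument, so it applies directly to subspaces of infinite-dimensional spaces.\<close>

lemma polytope_if_separating:
  fixes f :: "'i \<Rightarrow> 'a::real_vector \<Rightarrow> real"
  assumes S: "subspace S" and I: "finite I" and lin: "\<And>i. i \<in> I \<Longrightarrow> linear (f i)"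
    and sep: "\<And>y. y \<in> S \<Longrightarrow> (\<And>i. i \<in> I \<Longrightarrow> f i y \<le> 0) \<Longrightarrow> y = 0"
  shows "polytope {x \<in> S. \<forall>i\<in>I. f i x \<le> 1}"
proof -
  define C where "C = {x \<in> S. \<forall>i\<in>I. f i x \<le> 1}"
  define act where "act x = {i \<in> I. f i x = 1}" for x
  define E where "E = {x \<in> C. \<forall>y\<in>S. (\<forall>i\<in>act x. f i y = 0) \<longrightarrow> y = 0}"
  have add: "f i (x + t *\<^sub>R y) = f i x + t * f i y" if "i \<in> I" for i x t y
    using lin[OF that] by (simp add: linear_add linear_scale)
  have "inj_on act E"
  proof (rule inj_onI)
    fix x y assume xy: "x \<in> E" "y \<in> E" "act x = act y"
    have "f i (x - y) = 0" if "i \<in> act x" for i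
    proof -
      have "i \<in> I" "f i x = 1" "f i y = 1" using that xy(3) by (auto simp: act_def)
      then show ?thesis using lin by (simp add: linear_diff)
    qed
    moreover have "x - y \<in> S" using xy S by (auto simp: E_def C_def subspace_diff)
    ultimately have "x - y = 0" using xy(1) by (auto simp: E_def)
    then show "x = y" by simp
  qed
  moreover have "finite (act ` E)"
    by (rule finite_subset[of _ "Pow I"]) (use I in \<open>auto simp: act_def\<close>)
  ultimately have "finite E" by (simp add: finite_image_iff)
  have push: "\<exists>t>0. x + t *\<^sub>R y \<in> C \<and> act x \<subset> act (x + t *\<^sub>R y)"
    if x: "x \<in> C" and y: "y \<in> S" "y \<noteq> 0" "\<And>i. i \<in> act x \<Longrightarrow> f i y = 0" for x y
  proof -
    define P where "P = {i \<in> I. f i y > 0}"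
    \<comment> \<open>The time at which constraint \<open>i\<close> becomes active when leaving \<open>x\<close> in direction \<open>y\<close>.\<close>
    define r where "r i = (1 - f i x) / f i y" for i
    have P: "finite P" "P \<noteq> {}" using I sep[OF y(1)] y(2) unfolding P_def
      by (auto simp flip: not_le)
    have rpos: "r i > 0" if "i \<in> P" for i
    proof -
      have "f i x \<le> 1" "f i x \<noteq> 1" using that x y(3)[of i] by (auto simp: P_def C_def act_def)
      then show ?thesis using that by (auto simp: P_def r_def)
    qed
    define t where "t = Min (r ` P)"
    have "t \<in> r ` P" unfolding t_def using P by (intro Min_in) auto
    then obtain j where j: "j \<in> P" "t = r j" by auto
    have t: "t > 0" using rpos j by auto
    have "f i x + t * f i y \<le> 1" if "i \<in> I" for i
    proof (cases "i \<in> P")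
      case True
      then have "t \<le> r i" unfolding t_def using P by (intro Min_le) auto
      then show ?thesis using True by (simp add: P_def r_def field_simps)
    next
      case False
      then have "t * f i y \<le> 0" using that t by (simp add: P_def mult_le_0_iff)
      then show ?thesis using that x by (auto simp: C_def)
    qed
    then have "x + t *\<^sub>R y \<in> C"
      using x y(1) S by (simp add: C_def add subspace_add subspace_scale)
    moreover have "act x \<subseteq> act (x + t *\<^sub>R y)" using y(3) by (auto simp: act_def add)
    moreover have "j \<in> act (x + t *\<^sub>R y)" "j \<notin> act x"
      using j rpos[of j] y(3)[of j] by (auto simp: act_def P_def add r_def)
    ultimately show ?thesis using t by blast
  qed
  have hull: "x \<in> convex hull E" if "x \<in> C" for x
    using that
  proof (induction "card I - card (act x)" arbitrary: x rule: less_induct)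
    case less
    show ?case
    proof (cases "x \<in> E")
      case True
      then show ?thesis by (rule hull_inc)
    next
      case False
      then obtain y where y: "y \<in> S" "y \<noteq> 0" "\<And>i. i \<in> act x \<Longrightarrow> f i y = 0"
        using less.prems by (auto simp: E_def)
      have y': "- y \<in> S" "- y \<noteq> 0" "\<And>i. i \<in> act x \<Longrightarrow> f i (- y) = 0"
        using y S lin by (auto simp: subspace_neg linear_neg act_def)
      have closer: "z \<in> convex hull E" if "z \<in> C" "act x \<subset> act z" for z
      proof (rule less.hyps[OF _ that(1)])
        have "act z \<subseteq> I" by (auto simp: act_def)
        then have "card (act x) < card (act z)" "card (act z) \<le> card I"
          using that(2) I by (auto intro!: psubset_card_mono card_mono intro: finite_subset)
        then show "card I - card (act z) < card I - card (act x)" by linarith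
      qed
      obtain s where s: "s > 0" "x + s *\<^sub>R y \<in> convex hull E"
        using push[OF less.prems y] closer by blast
      obtain t where t: "t > 0" "x + t *\<^sub>R (- y) \<in> convex hull E"
        using push[OF less.prems y'] closer by blast
      have one: "t / (s + t) + s / (s + t) = 1"
        using s(1) t(1) by (simp add: add_divide_distrib[symmetric] add.commute)
      then have "(t / (s + t)) *\<^sub>R (x + s *\<^sub>R y) + (s / (s + t)) *\<^sub>R (x + t *\<^sub>R (- y)) \<in> convex hull E"
        using s t by (intro convexD[OF convex_convex_hull]) auto
      moreover have "(t / (s + t)) *\<^sub>R (x + s *\<^sub>R y) + (s / (s + t)) *\<^sub>R (x + t *\<^sub>R (- y))
          = (t / (s + t) + s / (s + t)) *\<^sub>R x"
        by (simp add: algebra_simps)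
      ultimately show ?thesis by (simp only: one scaleR_one)
    qed
  qed
  have "convex C"
    unfolding convex_def C_def
  proof (intro ballI allI impI CollectI conjI)
    fix x y and u v :: real
    assume xy: "x \<in> {x \<in> S. \<forall>i\<in>I. f i x \<le> 1}" "y \<in> {x \<in> S. \<forall>i\<in>I. f i x \<le> 1}"
      and uv: "0 \<le> u" "0 \<le> v" "u + v = 1"
    then show "u *\<^sub>R x + v *\<^sub>R y \<in> S" using S by (simp add: subspace_add subspace_scale)
    fix i assume i: "i \<in> I"
    have "u * f i x + v * f i y \<le> 1"
      using i xy uv by (intro convex_bound_le) auto
    then show "f i (u *\<^sub>R x + v *\<^sub>R y) \<le> 1" using lin[OF i] by (simp add: linear_add linear_scale)
  qed
  then have "convex hull E \<subseteq> C" by (intro hull_minimal) (auto simp: E_def)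
  with hull have "C = convex hull E" by blast
  with \<open>finite E\<close> show ?thesis unfolding polytope_def C_def by blast
qed

text \<open>Induction on the spanning set. A new vector \<open>b\<close> has a positive distance \<open>d\<close> from the span of the
  others, as balls of that span are compact and hence closed. The distance bounds the coefficient of
  \<open>b\<close> and thus exhibits the new ball as a closed subset of the continuous image of a compact product.\<close>

lemma compact_cball_Int_span:
  fixes B :: "'a::real_normed_vector set"
  assumes "finite B"
  shows "compact (cball 0 r \<inter> span B)"
  using assms
proof (induction B arbitrary: r)
  case empty
  then show ?case by (cases "r \<ge> 0") auto
next
  case (insert b B)
  show ?case
  proof (cases "b \<in> span B")
    case True
    then show ?thesis using insert.IH by (simp add: span_redundant)
  next
    case False
    have "closed (cball 0 (norm b + 1) \<inter> span B)"
      by (rule compact_imp_closed) (rule insert.IH)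
    then have "open (- (cball 0 (norm b + 1) \<inter> span B))" by (rule open_Compl)
    with False obtain e where e: "e > 0" "ball b e \<inter> (cball 0 (norm b + 1) \<inter> span B) = {}"
      unfolding open_contains_ball by (metis ComplI IntE disjoint_eq_subset_Compl)
    \<comment> \<open>With \<open>d \<le> 1\<close>, a point of the span closer than \<open>d\<close> to \<open>b\<close> lies in the ball of radius \<open>norm b + 1\<close>.\<close>
    define d where "d = min e 1"
    have d: "d > 0" using e(1) by (simp add: d_def)
    have far: "norm (b - v) \<ge> d" if "v \<in> span B" for v
    proof (rule ccontr)
      assume *: "\<not> norm (b - v) \<ge> d"
      have "norm v \<le> norm b + norm (b - v)"
        by (metis norm_minus_commute norm_triangle_sub)
      then have "v \<in> ball b e \<inter> (cball 0 (norm b + 1) \<inter> span B)"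
        using * that by (auto simp: d_def dist_norm)
      then show False using e(2) by blast
    qed
    have coef: "\<bar>t\<bar> * d \<le> norm (t *\<^sub>R b + v)" if "v \<in> span B" for t v
    proof (cases "t = 0")
      case False
      have "t *\<^sub>R b + v = t *\<^sub>R (b - (- inverse t) *\<^sub>R v)"
        using False by (simp add: scaleR_right_distrib)
      then have eq: "norm (t *\<^sub>R b + v) = \<bar>t\<bar> * norm (b - (- inverse t) *\<^sub>R v)"
        by (simp only: norm_scaleR)
      show ?thesis
        unfolding eq by (rule mult_left_mono[OF far[OF span_scale[OF that]] abs_ge_zero])
    qed simp
    define R where "R = r + r / d * norm b"
    define K where "K = (\<lambda>(t, v). t *\<^sub>R b + v) ` ({- (r / d)..r / d} \<times> (cball 0 R \<inter> span B))"
    have "compact K" unfolding K_def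
      by (intro compact_continuous_image compact_Times insert.IH compact_Icc)
        (auto simp: case_prod_unfold intro!: continuous_intros)
    moreover have "cball 0 r \<inter> span (insert b B) = cball 0 r \<inter> K"
    proof (intro equalityI subsetI IntI)
      fix x assume x: "x \<in> cball 0 r \<inter> span (insert b B)"
      then show "x \<in> cball 0 r" by simp
      obtain t v where tv: "x = t *\<^sub>R b + v" "v \<in> span B"
      proof -
        obtain t where "x - t *\<^sub>R b \<in> span B" using x by (auto simp: span_breakdown_eq)
        then show thesis using that[of t "x - t *\<^sub>R b"] by simp
      qed
      have t: "\<bar>t\<bar> \<le> r / d"
        using coef[OF tv(2), of t] x d by (simp add: tv(1) field_simps)
      have "norm v \<le> norm x + norm (t *\<^sub>R b)"
        using tv(1) norm_triangle_ineq4[of x "t *\<^sub>R b"] by simp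
      also have "\<dots> \<le> R"
        unfolding R_def norm_scaleR using x t by (intro add_mono mult_right_mono) auto
      finally show "x \<in> K" unfolding K_def using tv t by (auto simp: abs_le_iff intro!: image_eqI[of _ _ "(t, v)"])
    next
      fix x assume x: "x \<in> cball 0 r \<inter> K"
      then show "x \<in> cball 0 r" by simp
      obtain t v where "x = t *\<^sub>R b + v" "v \<in> span B" using x by (auto simp: K_def)
      then have "x - t *\<^sub>R b \<in> span B" by simp
      then show "x \<in> span (insert b B)" unfolding span_breakdown_eq by blast
    qed
    ultimately show ?thesis by (simp add: closed_Int_compact)
  qed
qed

section \<open>Polyhedrality of \<open>W\<close>\<close>

text \<open>All weights are positive, so a vanishing average excludes a nonzero sequence of one sign.\<close>

lemma W_lim_zero_pos:
  assumes "W_lim z = 0" "z \<noteq> 0"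
  shows "\<exists>i. W_nth z i > 0"
proof (rule ccontr)
  assume "\<not> ?thesis"
  then have np: "W_nth z i \<le> 0" for i by (auto simp: not_less)
  have "(\<lambda>i. - (W_nth z i / 2 ^ Suc i)) sums 0"
    using sums_minus[OF W_nth_sums[of z]] assms(1) by simp
  moreover have "0 \<le> - (W_nth z i / 2 ^ Suc i)" for i
    using np[of i] by (simp add: divide_nonpos_pos)
  ultimately have "\<forall>i. - (W_nth z i / 2 ^ Suc i) = 0"
    by (subst suminf_eq_zero_iff[symmetric]) (simp_all only: sums_iff)
  then have "z = 0" by (intro W_eqI) simp
  then show False using assms(2) by simp
qed

text \<open>Near \<open>z\<close> in the unit sphere, a coordinate \<open>p\<close> with \<open>z p > 0\<close> keeps dominating a whole tail. Finitely
  many such neighbourhoods cover the sphere, and the claim is invariant under positive scaling.\<close>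

lemma uniform_max_on_lim_zero:
  assumes "finite B" and lim: "\<And>z. z \<in> span B \<Longrightarrow> W_lim z = 0"
  obtains N where "\<And>z j. z \<in> span B \<Longrightarrow> \<exists>i<N. W_nth z j \<le> W_nth z i"
proof -
  define K where "K = cball 0 1 \<inter> span B \<inter> {z. norm z = 1}"
  have "compact K" unfolding K_def
    by (intro compact_Int_closed compact_cball_Int_span[OF assms(1)] closed_Collect_eq continuous_intros)
  have local: "\<exists>e>0. \<exists>N. \<forall>z'\<in>ball z e. \<forall>j. \<exists>i<N. W_nth z' j \<le> W_nth z' i" if "z \<in> K" for z
  proof -
    have z: "W_lim z = 0" "z \<noteq> 0" using that lim by (auto simp: K_def)
    then obtain p where p: "W_nth z p > 0" using W_lim_zero_pos by blast
    define e where "e = W_nth z p / 3"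
    have e: "e > 0" using p by (simp add: e_def)
    obtain n where n: "\<And>j. j \<ge> n \<Longrightarrow> \<bar>W_nth z j\<bar> < e"
      using LIMSEQ_D[OF W_nth_tendsto[of z] e] z(1) by auto
    have "\<exists>i<max n (Suc p). W_nth z' j \<le> W_nth z' i" if z': "z' \<in> ball z e" for z' j
    proof (cases "j < n")
      case True
      then show ?thesis by (intro exI[of _ j]) auto
    next
      case False
      have near: "\<bar>W_nth z k - W_nth z' k\<bar> < e" for k
        using abs_W_nth_le_norm[of "z - z'" k] z' by (simp add: dist_norm)
      have "W_nth z' j \<le> W_nth z' p"
        using near[of j] near[of p] n[of j] False unfolding e_def by linarith
      then show ?thesis by (intro exI[of _ p]) auto
    qed
    then show ?thesis using e by blast
  qed
  then obtain e N where e: "\<And>z. z \<in> K \<Longrightarrow> e z > 0"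
    and N: "\<And>z z' j. z \<in> K \<Longrightarrow> z' \<in> ball z (e z) \<Longrightarrow> \<exists>i<N z. W_nth z' j \<le> W_nth z' i"
    by metis
  have "K \<subseteq> (\<Union>z\<in>K. ball z (e z))" using e by force
  then obtain F where F: "F \<subseteq> K" "finite F" "K \<subseteq> (\<Union>z\<in>F. ball z (e z))"
    using compactE_image[OF \<open>compact K\<close>, of K "\<lambda>z. ball z (e z)"] by auto
  define M where "M = Max (insert 1 (N ` F))"
  have M: "M > 0" "\<And>z. z \<in> F \<Longrightarrow> N z \<le> M"
  proof -
    have "1 \<le> M" unfolding M_def using F(2) by (intro Max_ge) auto
    then show "M > 0" by simp
    show "N z \<le> M" if "z \<in> F" for z unfolding M_def using F(2) that by (intro Max_ge) auto
  qed
  show thesis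
  proof (rule that[of M])
    fix z j assume z: "z \<in> span B"
    show "\<exists>i<M. W_nth z j \<le> W_nth z i"
    proof (cases "z = 0")
      case True
      then show ?thesis using M(1) by auto
    next
      case False
      define u where "u = z /\<^sub>R norm z"
      have "u \<in> K" using z False by (simp add: K_def u_def span_scale)
      then obtain x where x: "x \<in> F" "u \<in> ball x (e x)" using F(3) by blast
      then obtain i where "i < N x" "W_nth u j \<le> W_nth u i" using N F(1) by blast
      then have "i < M" "W_nth z j \<le> W_nth z i"
        using M(2)[OF x(1)] False by (auto simp: u_def mult_left_le_imp_le)
      then show ?thesis by blast
    qed
  qed
qed

text \<open>Subtracting the limit from \<open>x\<close> leaves a vector with limit 0 and shifts all the coordinates
  equally, so the coordinates at which \<open>x\<close> attains its supremum and infimum can be found among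
  the first \<open>N\<close>.\<close>

lemma norm_determined_in_finite_dim:
  assumes "finite_dim S"
  obtains N where "\<And>x b. x \<in> S \<Longrightarrow> (\<And>i. i < N \<Longrightarrow> \<bar>W_nth x i\<bar> \<le> b) \<Longrightarrow> norm x \<le> b"
proof -
  obtain B where B: "finite B" "S \<subseteq> span B" using assms by (auto simp: finite_dim_def)
  define T where "T x = x - W_lim x *\<^sub>R W_one" for x
  have T: "linear T"
    by (rule linearI)
      (simp_all add: T_def linear_add[OF linear_W_lim] linear_scale[OF linear_W_lim]
        scaleR_add_left scaleR_diff_right)
  have TS: "span (T ` B) = T ` span B" using linear_span_image[OF T] .
  have "W_lim (T x) = 0" for x
    by (simp add: W_lim_W_one T_def linear_diff[OF linear_W_lim] linear_scale[OF linear_W_lim])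
  then obtain N where N: "\<And>z j. z \<in> span (T ` B) \<Longrightarrow> \<exists>i<N. W_nth z j \<le> W_nth z i"
    using uniform_max_on_lim_zero[of "T ` B"] B(1) unfolding TS by blast
  show thesis
  proof (rule that)
    fix x b assume x: "x \<in> S" and b: "\<And>i. i < N \<Longrightarrow> \<bar>W_nth x i\<bar> \<le> b"
    have Tx: "T x \<in> span (T ` B)" using x B(2) unfolding TS by blast
    show "norm x \<le> b"
    proof (rule W_norm_le)
      fix j
      obtain i where i: "i < N" "W_nth (T x) j \<le> W_nth (T x) i" using N[OF Tx] by blast
      obtain k where k: "k < N" "W_nth (- T x) j \<le> W_nth (- T x) k" using N[OF span_neg[OF Tx]] by blast
      show "\<bar>W_nth x j\<bar> \<le> b"
        using i k b[of i] b[of k] by (simp add: T_def)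
    qed
  qed
qed

lemma polyhedral_W: "polyhedral_space TYPE(W)"
  unfolding polyhedral_space_def
proof (intro allI impI)
  fix S :: "W set" assume S: "subspace S \<and> finite_dim S"
  then obtain N where N: "\<And>x b. x \<in> S \<Longrightarrow> (\<And>i. i < N \<Longrightarrow> \<bar>W_nth x i\<bar> \<le> b) \<Longrightarrow> norm x \<le> b"
    using norm_determined_in_finite_dim by blast
  define f where "f = (\<lambda>(i, s) x. s * W_nth x i)"
  define I where "I = {..<N} \<times> {1, -1::real}"
  have bnd: "\<bar>W_nth x i\<bar> \<le> b" if "\<forall>p\<in>I. f p x \<le> b" "i < N" for x i b
    using bspec[OF that(1), of "(i, 1)"] bspec[OF that(1), of "(i, -1)"] that(2)
    by (auto simp: I_def f_def)
  have "polytope {x \<in> S. \<forall>p\<in>I. f p x \<le> 1}"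
  proof (rule polytope_if_separating)
    show "linear (f p)" for p
      unfolding f_def by (cases p) (auto intro!: linearI simp: algebra_simps)
    fix y assume "y \<in> S" "\<And>p. p \<in> I \<Longrightarrow> f p y \<le> 0"
    then have "norm y \<le> 0" using N bnd by blast
    then show "y = 0" by simp
  qed (use S in \<open>auto simp: I_def\<close>)
  moreover have "{x \<in> S. \<forall>p\<in>I. f p x \<le> 1} = cball 0 1 \<inter> S"
  proof (intro equalityI subsetI)
    fix x assume "x \<in> {x \<in> S. \<forall>p\<in>I. f p x \<le> 1}"
    then show "x \<in> cball 0 1 \<inter> S" using N bnd[of x 1] by simp
  next
    fix x assume x: "x \<in> cball 0 1 \<inter> S"
    then have "\<bar>W_nth x i\<bar> \<le> 1" for i using abs_W_nth_le_norm[of x i] by simp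
    then show "x \<in> {x \<in> S. \<forall>p\<in>I. f p x \<le> 1}" using x by (auto simp: I_def f_def abs_le_iff)
  qed
  ultimately show "polytope (cball 0 1 \<inter> S)" by simp
qed

section \<open>\<open>W\<close> contains no copy of \<open>c\<close>\<close>

text \<open>The vectors \<open>x m\<close> have norm 1 and lie in the span of \<open>1, t, t\<^sup>2\<close>. In \<open>W\<close> the image of this span is
  normed by finitely many coordinates, so some two distinct \<open>x m\<close>, \<open>x n\<close> take the same value \<open>\<plusminus>1\<close> at a common
  coordinate and their sum has norm 2. In \<open>c\<close>, however, \<open>x m\<close> and \<open>x n\<close> peak at different places, and
  the sum has norm less than 2.\<close>

lemma no_isometric_copy_of_c:
  fixes S :: "W set"
  assumes "isometric_subspace S TYPE(cseq)"
  shows False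
proof -
  obtain T :: "cseq \<Rightarrow> W" where T: "linear T" "\<And>x. norm (T x) = norm x"
    using assms unfolding isometric_subspace_def linear_isometry_def by blast
  define t :: "nat \<Rightarrow> real" where "t n = 1 / real (Suc n)" for n
  have "t \<longlonglongrightarrow> 0" using LIMSEQ_inverse_real_of_nat by (simp add: t_def[abs_def] inverse_eq_divide)
  define p :: "nat \<Rightarrow> cseq" where "p k = Cseq (\<lambda>n. t n ^ k)" for k
  have p: "cseq_nth (p k) n = t n ^ k" for k n
  proof -
    have "convergent (\<lambda>n. t n ^ k)"
      using tendsto_power[OF \<open>t \<longlonglongrightarrow> 0\<close>] by (rule convergentI)
    then show ?thesis by (simp add: p_def Cseq_inverse)
  qed
  define x where "x m = (1 - (t m)\<^sup>2) *\<^sub>R p 0 + (2 * t m) *\<^sub>R p 1 - p 2" for m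
  have x: "cseq_nth (x m) n = 1 - (t n - t m)\<^sup>2" for m n
    by (simp add: x_def p power2_eq_square algebra_simps)
  have t01: "0 \<le> t n" "t n \<le> 1" for n by (simp_all add: t_def)
  have sq: "(t n - t m)\<^sup>2 \<le> 1" for n m
    using t01[of n] t01[of m] by (simp add: abs_square_le_1 abs_le_iff)
  have nx: "norm (x m) = 1" for m
  proof (rule antisym)
    show "norm (x m) \<le> 1" by (rule cseq_norm_le) (use sq in \<open>simp add: x abs_le_iff\<close>)
    show "1 \<le> norm (x m)" using cseq_nth_le_norm[of "x m" m] by (simp add: x)
  qed
  have sum_small: "norm (x m + x n) < 2" if "m \<noteq> n" for m n
  proof -
    have "t m \<noteq> t n" using that by (simp add: t_def)
    have "norm (x m + x n) \<le> 2 - (t m - t n)\<^sup>2 / 2"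
    proof (rule cseq_norm_le)
      fix k
      \<comment> \<open>The sum of the squared distances to two points is smallest at their midpoint.\<close>
      have "(t m - t n)\<^sup>2 / 2 \<le> (t k - t m)\<^sup>2 + (t k - t n)\<^sup>2"
        using zero_le_power2[of "(t k - t m) + (t k - t n)"] by (simp add: power2_eq_square field_simps)
      moreover have "(t m - t n)\<^sup>2 \<le> 1" by (rule sq)
      ultimately show "\<bar>cseq_nth (x m + x n) k\<bar> \<le> 2 - (t m - t n)\<^sup>2 / 2"
        using sq[of k m] sq[of k n] by (simp add: x abs_le_iff)
    qed
    also have "\<dots> < 2" using \<open>t m \<noteq> t n\<close> by simp
    finally show ?thesis .
  qed
  define S' where "S' = span {T (p 0), T (p 1), T (p 2)}"
  have "finite_dim S'"
    unfolding finite_dim_def S'_def by (intro exI[of _ "{T (p 0), T (p 1), T (p 2)}"]) simp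
  then obtain N where N: "\<And>y b. y \<in> S' \<Longrightarrow> (\<And>i. i < N \<Longrightarrow> \<bar>W_nth y i\<bar> \<le> b) \<Longrightarrow> norm y \<le> b"
    using norm_determined_in_finite_dim by blast
  have TS: "T (x m) \<in> S'" for m
    unfolding x_def linear_diff[OF T(1)] linear_add[OF T(1)] linear_scale[OF T(1)] S'_def
    by (intro span_add span_diff span_scale span_base) auto
  have "\<exists>i<N. \<bar>W_nth (T (x m)) i\<bar> = 1" for m
  proof (rule ccontr)
    assume *: "\<not> ?thesis"
    have lt: "\<bar>W_nth (T (x m)) i\<bar> < 1" if "i < N" for i
      using abs_W_nth_le_norm[of "T (x m)" i] * that unfolding T(2) nx by (metis order.strict_iff_order)
    define b where "b = Max (insert 0 ((\<lambda>i. \<bar>W_nth (T (x m)) i\<bar>) ` {..<N}))"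
    have "b < 1" unfolding b_def using lt by (subst Max_less_iff) auto
    moreover have "norm (T (x m)) \<le> b"
      by (rule N[OF TS]) (auto simp: b_def intro!: Max_ge)
    ultimately show False by (simp add: T nx)
  qed
  then obtain c where c: "\<And>m. c m < N" "\<And>m. \<bar>W_nth (T (x m)) (c m)\<bar> = 1" by metis
  define h where "h m = (c m, W_nth (T (x m)) (c m))" for m
  have "range h \<subseteq> {..<N} \<times> {1, -1}"
    using c by (auto simp: h_def abs_eq_iff') 
  then have "finite (range h)" by (rule finite_subset) auto
  then have "\<not> inj h" using finite_imageD infinite_UNIV_nat by blast
  then obtain m n where mn: "h m = h n" "m \<noteq> n" by (auto simp: inj_def)
  have "2 = \<bar>W_nth (T (x m + x n)) (c m)\<bar>"
    using mn(1) c(2)[of m] by (auto simp: h_def linear_add[OF T(1)])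
  also have "\<dots> \<le> norm (x m + x n)" using abs_W_nth_le_norm T(2) by metis
  finally show False using sum_small[OF mn(2)] by simp
qed

section \<open>The five properties of \<open>W\<close>\<close>

theorem mainTheorem1:
  shows
    "(linear_isometry phi \<and> surj phi \<and> limitin sigma_l1_W l1_basis e_star sequentially) \<and>
     \<not> (\<exists>S :: W set. isometric_subspace S TYPE(cseq)) \<and>
     (\<not> finite_dim (affine hull K_set) \<and>
      closedin sigma_l1_W K_set \<and>
      K_set face_of cball 0 1 \<and> K_set \<noteq> cball 0 1) \<and>
     (W_one extreme_point_of cball 0 1 \<and>
      choquet_simplex sigma_l1_W K_set \<and>
      isometric_to_affine_cont TYPE(W) sigma_l1_W K_set) \<and>
     polyhedral_space TYPE(W)"
  unfolding linear_isometry_def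
  using linear_phi norm_phi surj_phi limitin_l1_basis no_isometric_copy_of_c infinite_dim_K closedin_K
    face_K K_ne_cball extreme_W_one choquet_K isometric_AK polyhedral_W
  by (intro conjI) (simp_all, blast)

end
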